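(* There exists a Corson compact space which is not semi-Eberlein. In fact, let $A\subseteq\omega_1$ be a stationary set whose complement $\omega_1\setminus A$ is also stationary, and let $T$ be the tree of all subsets of $A$ which are closed in $\omega_1$, ordered by end-extension. Then the space $P(T)$ is a Corson compact space which is not semi-Eberlein.
   Context: For a tree $T$, $P(T)$ is the set of all initial branches of $T$, i.e. of all linearly ordered sets $x\subseteq T$ such that $t\in x$ and $s<t$ imply $s\in x$, with the topology induced from the Cantor cube $\{0,1\}^T$ (identifying sets with their characteristic functions). The end-extension order: $s\le t$ iff $s$ is an initial segment of $t$ (as a set of ordinals). For a set $S$, $\Sigma(S)$ is the set of all $x\in\mathbb{R}^S$ with $\{s\in S : x(s)\ne0\}$ countable, and $c_0(S)$ is the set of all $x\in\mathbb{R}^S$ such that for every $\varepsilon>0$ the set $\{s\in S : |x(s)|>\varepsilon\}$ is finite; $\mathbb{R}^S$ carries the product topology. A compact (Hausdorff) space is Corson compact if it embeds topologically into $\Sigma(S)\subseteq\mathbb{R}^S$ for some set $S$. A compact space $K$ is semi-Eberlein if for some set $S$ there is a topological embedding of $K$ into $\mathbb{R}^S$ such that, identifying $K$ with its image, $c_0(S)\cap K$ is dense in $K$. *)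

theory Defs
  imports "HOL-Analysis.Analysis" "HOL-Library.Countable_Set_Type"
begin

text \<open>The ordinal \<open>\<omega>\<^sub>1\<close> as a type: the initial well-order of the cardinal successor of
  \<open>\<aleph>\<^sub>0\<close>. It carries the order topology.\<close>

typedef omega1 = "Field (cardSuc natLeq)"
  using Field_cardSuc_not_empty[OF natLeq_Card_order] by blast

instantiation omega1 :: wellorder
begin

definition less_eq_omega1 :: "omega1 \<Rightarrow> omega1 \<Rightarrow> bool" where
  "(a :: omega1) \<le> b \<longleftrightarrow> (Rep_omega1 a, Rep_omega1 b) \<in> cardSuc natLeq"

definition less_omega1 :: "omega1 \<Rightarrow> omega1 \<Rightarrow> bool" where
  "(a :: omega1) < b \<longleftrightarrow> a \<le> b \<and> a \<noteq> b"

instance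
proof -
  let ?r = "cardSuc natLeq"
  have wo: "well_order_on (Field ?r) ?r"
    by (rule cardSuc_Well_order[OF natLeq_Card_order])
  then have lin: "linear_order_on (Field ?r) ?r" and wf: "wf (?r - Id)"
    by (auto simp: well_order_on_def)
  have refl: "refl_on (Field ?r) ?r" and tr: "trans ?r" and as: "antisym ?r"
    and tot: "total_on (Field ?r) ?r"
    using lin by (auto simp: linear_order_on_def partial_order_on_def preorder_on_def)
  have r: "(Rep_omega1 x, Rep_omega1 x) \<in> ?r" for x
    using refl Rep_omega1[of x] by (auto simp: refl_on_def)
  show "OFCLASS(omega1, wellorder_class)"
  proof
    fix x y z :: omega1
    show antis: "x < y \<longleftrightarrow> x \<le> y \<and> \<not> y \<le> x"
      using as r unfolding less_omega1_def less_eq_omega1_def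
      by (metis Rep_omega1_inject antisymD)
    show "x \<le> x" using r by (simp add: less_eq_omega1_def)
    show "x \<le> y \<Longrightarrow> y \<le> z \<Longrightarrow> x \<le> z"
      using tr unfolding less_eq_omega1_def by (meson transD)
    show "x \<le> y \<Longrightarrow> y \<le> x \<Longrightarrow> x = y"
      using as unfolding less_eq_omega1_def by (metis Rep_omega1_inject antisymD)
    show "x \<le> y \<or> y \<le> x"
      using tot Rep_omega1[of x] Rep_omega1[of y] r
      unfolding less_eq_omega1_def total_on_def by (metis)
  next
    fix P :: "omega1 \<Rightarrow> bool" and a
    assume step: "\<And>x. (\<And>y. y < x \<Longrightarrow> P y) \<Longrightarrow> P x"
    have "wf {(x, y). x < (y :: omega1)}"
      by (rule wf_subset[OF wf_inv_image[OF wf, of Rep_omega1]])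
        (auto simp: less_omega1_def less_eq_omega1_def inv_image_def Rep_omega1_inject)
    then show "P a"
      by (induction a rule: wf_induct_rule) (auto intro: step)
  qed
qed

end

instantiation omega1 :: linorder_topology
begin

definition open_omega1 :: "omega1 set \<Rightarrow> bool" where
  "open_omega1 = generate_topology (range lessThan \<union> range greaterThan)"

instance
  by standard (simp add: open_omega1_def fun_eq_iff)

end

text \<open>Up to isomorphism the type is the unique well-order with the following two properties.\<close>

lemma uncountable_UNIV_omega1: "uncountable (UNIV :: omega1 set)"
  including cardinal_syntax
proof
  assume "countable (UNIV :: omega1 set)"
  then have "countable (range Rep_omega1)" by (rule countable_image)
  then have "countable (Field (cardSuc natLeq))"
    by (simp add: type_definition.Rep_range[OF type_definition_omega1])
  then have "|Field (cardSuc natLeq)| \<le>o natLeq"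
    by (simp add: countable_card_le_natLeq)
  moreover have "|Field (cardSuc natLeq)| =o cardSuc natLeq"
    by (rule card_of_Field_ordIso[OF cardSuc_Card_order[OF natLeq_Card_order]])
  ultimately have "cardSuc natLeq \<le>o natLeq"
    by (meson ordIso_ordLeq_trans ordIso_symmetric)
  then show False
    using cardSuc_greater[OF natLeq_Card_order] not_ordLess_ordLeq by blast
qed

lemma countable_lessThan_omega1: "countable {..<a :: omega1}"
  including cardinal_syntax
proof -
  let ?r = "cardSuc natLeq"
  have "|underS ?r (Rep_omega1 a)| <o ?r"
    by (rule card_of_underS[OF cardSuc_Card_order[OF natLeq_Card_order] Rep_omega1])
  then have "|underS ?r (Rep_omega1 a)| \<le>o natLeq"
    by (simp add: cardSuc_ordLess_ordLeq[OF natLeq_Card_order card_of_Card_order]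
        cardSuc_ordLeq_ordLess[OF natLeq_Card_order card_of_Card_order])
  then have "countable (underS ?r (Rep_omega1 a))"
    by (simp add: countable_card_le_natLeq)
  moreover have "Rep_omega1 ` {..<a} \<subseteq> underS ?r (Rep_omega1 a)"
    by (auto simp: underS_def less_omega1_def less_eq_omega1_def Rep_omega1_inject)
  ultimately have "countable (Rep_omega1 ` {..<a})"
    by (rule countable_subset[rotated])
  moreover have "inj_on Rep_omega1 {..<a}"
    by (simp add: inj_on_def Rep_omega1_inject)
  ultimately show ?thesis by (simp add: countable_image_inj_eq)
qed

definition club :: "omega1 set \<Rightarrow> bool" where
  "club C \<longleftrightarrow> closed C \<and> (\<forall>a. \<exists>b\<in>C. a < b)"

definition stationary :: "omega1 set \<Rightarrow> bool" where
  "stationary A \<longleftrightarrow> (\<forall>C. club C \<longrightarrow> A \<inter> C \<noteq> {})"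

text \<open>A tree is given by its set \<open>T\<close> of nodes and its (reflexive) order \<open>le\<close>.\<close>

definition initial_branches :: "'a set \<Rightarrow> ('a \<Rightarrow> 'a \<Rightarrow> bool) \<Rightarrow> 'a set set" where
  "initial_branches T le = {x. x \<subseteq> T \<and> (\<forall>s\<in>x. \<forall>t\<in>x. le s t \<or> le t s) \<and>
     (\<forall>t\<in>x. \<forall>s\<in>T. le s t \<and> s \<noteq> t \<longrightarrow> s \<in> x)}"

definition cantor_cube :: "'a set \<Rightarrow> ('a \<Rightarrow> nat) topology" where
  "cantor_cube T = product_topology (\<lambda>_. discrete_topology {0, 1}) T"

definition path_space :: "'a set \<Rightarrow> ('a \<Rightarrow> 'a \<Rightarrow> bool) \<Rightarrow> 'a set topology" where
  "path_space T le =
     pullback_topology (initial_branches T le) (\<lambda>x. restrict (indicator x) T) (cantor_cube T)"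

lemma topspace_path_space [simp]: "topspace (path_space T le) = initial_branches T le"
  by (auto simp: path_space_def topspace_pullback_topology cantor_cube_def indicator_def)

definition initial_segment :: "'a::linorder set \<Rightarrow> 'a set \<Rightarrow> bool" where
  "initial_segment s t \<longleftrightarrow> s \<subseteq> t \<and> (\<forall>b\<in>s. \<forall>a\<in>t. a < b \<longrightarrow> a \<in> s)"

definition closed_subsets :: "omega1 set \<Rightarrow> omega1 set set" where
  "closed_subsets A = {t. t \<subseteq> A \<and> closed t}"

definition real_power :: "'s set \<Rightarrow> ('s \<Rightarrow> real) topology" where
  "real_power S = product_topology (\<lambda>_. euclideanreal) S"

definition Sigma_product :: "'s set \<Rightarrow> ('s \<Rightarrow> real) set" where
  "Sigma_product S = {x \<in> topspace (real_power S). countable {s \<in> S. x s \<noteq> 0}}"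

definition c0 :: "'s set \<Rightarrow> ('s \<Rightarrow> real) set" where
  "c0 S = {x \<in> topspace (real_power S). \<forall>\<epsilon>>0. finite {s \<in> S. \<bar>x s\<bar> > \<epsilon>}}"

definition Corson_compact_via :: "'s set \<Rightarrow> 'a topology \<Rightarrow> bool" where
  "Corson_compact_via S X \<longleftrightarrow> compact_space X \<and> Hausdorff_space X \<and>
     (\<exists>f. embedding_map X (subtopology (real_power S) (Sigma_product S)) f)"

definition semi_Eberlein_via :: "'s set \<Rightarrow> 'a topology \<Rightarrow> bool" where
  "semi_Eberlein_via S X \<longleftrightarrow> compact_space X \<and> Hausdorff_space X \<and>
     (\<exists>f. embedding_map X (real_power S) f \<and>
       subtopology (real_power S) (f ` topspace X) closure_of (c0 S \<inter> f ` topspace X)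
         = f ` topspace X)"

text \<open>A definition cannot quantify over the type of the index set. Taking \<open>S\<close> among the sets
  of functions \<open>'a \<Rightarrow> real\<close> is no restriction: \<open>Corson_compactI\<close> and \<open>semi_EberleinI\<close> below
  accept an index set of any type.\<close>

definition Corson_compact :: "'a topology \<Rightarrow> bool" where
  "Corson_compact X \<longleftrightarrow> (\<exists>S :: ('a \<Rightarrow> real) set. Corson_compact_via S X)"

definition semi_Eberlein :: "'a topology \<Rightarrow> bool" where
  "semi_Eberlein X \<longleftrightarrow> (\<exists>S :: ('a \<Rightarrow> real) set. semi_Eberlein_via S X)"

lemma reindex_embedding:
  fixes S :: "'s set" and X :: "'a topology"
  assumes comp: "compact_space X" and emb: "embedding_map X (real_power S) f"
  obtains S' :: "('a \<Rightarrow> real) set" and \<phi> f' where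
    "embedding_map X (real_power S') f'" "\<phi> ` S' \<subseteq> S" "inj_on \<phi> S'"
    "\<And>x s. x \<in> topspace X \<Longrightarrow> s \<in> S' \<Longrightarrow> f' x s = f x (\<phi> s)"
proof -
  define h where "h = (\<lambda>s. restrict (\<lambda>x. f x s) (topspace X))"
  define S' where "S' = h ` S"
  define \<phi> where "\<phi> = inv_into S h"
  define f' where "f' = (\<lambda>x. restrict (\<lambda>g. g x :: real) S')"
  have \<phi>: "\<phi> g \<in> S" "h (\<phi> g) = g" if "g \<in> S'" for g
    using that unfolding S'_def \<phi>_def by (auto simp: inv_into_into f_inv_into_f)
  have f': "f' x g = f x (\<phi> g)" if "x \<in> topspace X" "g \<in> S'" for x g
  proof -
    have "f' x g = h (\<phi> g) x" using \<phi>[OF that(2)] that by (simp add: f'_def)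
    also have "\<dots> = f x (\<phi> g)" using that by (simp add: h_def)
    finally show ?thesis .
  qed
  have hf: "homeomorphic_map X (subtopology (real_power S) (f ` topspace X)) f"
    using emb by (simp add: embedding_map_def)
  then have cf: "continuous_map X (real_power S) f"
    using homeomorphic_imp_continuous_map continuous_map_in_subtopology by blast
  then have cfs: "continuous_map X euclideanreal (\<lambda>x. f x s)" if "s \<in> S" for s
    using that by (auto simp: real_power_def continuous_map_componentwise)
  have ext: "f x \<in> extensional S" if "x \<in> topspace X" for x
    using cf that by (auto simp: real_power_def continuous_map_componentwise)
  have inj: "inj_on f (topspace X)"
    using hf by (rule homeomorphic_imp_injective_map)
  have "continuous_map X euclideanreal (\<lambda>x. f' x g)" if "g \<in> S'" for g
    by (rule continuous_map_eq[OF cfs[OF \<phi>(1)[OF that]]]) (simp add: f' that)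
  then have cf': "continuous_map X (real_power S') f'"
    by (auto simp: real_power_def continuous_map_componentwise f'_def)
  have inj': "inj_on f' (topspace X)"
  proof (rule inj_onI)
    fix x y assume xy: "x \<in> topspace X" "y \<in> topspace X" "f' x = f' y"
    have "f x s = f y s" if "s \<in> S" for s
    proof -
      have "h s \<in> S'" using that by (simp add: S'_def)
      then have "h s x = h s y" using xy(3) by (auto simp: f'_def fun_eq_iff dest: spec[of _ "h s"])
      then show ?thesis using xy by (simp add: h_def)
    qed
    then have "f x = f y" using ext xy by (meson extensionalityI)
    then show "x = y" using inj xy by (auto dest: inj_onD)
  qed
  have "Hausdorff_space (real_power S')"
    by (simp add: real_power_def Hausdorff_space_product_topology Hausdorff_space_euclidean)
  then have "embedding_map X (real_power S') f'"
    using continuous_imp_embedding_map[OF cf' comp _ inj'] by blast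
  moreover have "\<phi> ` S' \<subseteq> S" using \<phi> by auto
  moreover have "inj_on \<phi> S'" by (metis \<phi>(2) inj_onI)
  ultimately show thesis using that f' by blast
qed

lemma Corson_compactI:
  fixes S :: "'s set" and X :: "'a topology"
  assumes "Corson_compact_via S X"
  shows "Corson_compact X"
proof -
  obtain f where comp: "compact_space X" and H: "Hausdorff_space X"
    and emb: "embedding_map X (subtopology (real_power S) (Sigma_product S)) f"
    using assms by (auto simp: Corson_compact_via_def)
  have emb1: "embedding_map X (real_power S) f" and sub: "f ` topspace X \<subseteq> Sigma_product S"
    using emb by (auto simp: embedding_map_in_subtopology)
  obtain S' :: "('a \<Rightarrow> real) set" and \<phi> f' where *: 
    "embedding_map X (real_power S') f'" "\<phi> ` S' \<subseteq> S" "inj_on \<phi> S'"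
    "\<And>x s. x \<in> topspace X \<Longrightarrow> s \<in> S' \<Longrightarrow> f' x s = f x (\<phi> s)"
    using reindex_embedding[OF comp emb1] by metis
  have "f' x \<in> Sigma_product S'" if x: "x \<in> topspace X" for x
  proof -
    have "f' x \<in> topspace (real_power S')"
      using *(1) x unfolding embedding_map_def
      by (metis IntD1 homeomorphic_imp_surjective_map imageI topspace_subtopology)
    moreover have "countable {s \<in> S. f x s \<noteq> 0}"
      using sub x by (auto simp: Sigma_product_def)
    then have "countable (\<phi> ` {s \<in> S'. f' x s \<noteq> 0})"
      by (rule countable_subset[rotated]) (use * x in auto)
    then have "countable {s \<in> S'. f' x s \<noteq> 0}"
      using *(3) by (metis (no_types, lifting) countable_image_inj_on inj_on_subset mem_Collect_eq subsetI)
    ultimately show ?thesis by (simp add: Sigma_product_def)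
  qed
  then have "embedding_map X (subtopology (real_power S') (Sigma_product S')) f'"
    using *(1) by (auto simp: embedding_map_in_subtopology)
  then show ?thesis using comp H by (auto simp: Corson_compact_def Corson_compact_via_def)
qed

lemma closure_of_embedding:
  assumes "embedding_map X Y f"
  shows "subtopology Y (f ` topspace X) closure_of (D \<inter> f ` topspace X) = f ` topspace X \<longleftrightarrow>
    X closure_of {x \<in> topspace X. f x \<in> D} = topspace X"
proof -
  let ?A = "{x \<in> topspace X. f x \<in> D}"
  have h: "homeomorphic_map X (subtopology Y (f ` topspace X)) f"
    using assms by (simp add: embedding_map_def)
  have "D \<inter> f ` topspace X = f ` ?A" by auto
  then have "subtopology Y (f ` topspace X) closure_of (D \<inter> f ` topspace X) = f ` (X closure_of ?A)"
    using homeomorphic_map_closure_of[OF h, of ?A] by auto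
  moreover have "inj_on f (topspace X)" using h by (rule homeomorphic_imp_injective_map)
  ultimately show ?thesis
    by (simp add: inj_on_image_eq_iff[OF _ closure_of_subset_topspace])
qed

lemma semi_EberleinI:
  fixes S :: "'s set" and X :: "'a topology"
  assumes "semi_Eberlein_via S X"
  shows "semi_Eberlein X"
proof -
  obtain f where comp: "compact_space X" and H: "Hausdorff_space X"
    and emb: "embedding_map X (real_power S) f"
    and dense: "X closure_of {x \<in> topspace X. f x \<in> c0 S} = topspace X"
    using assms by (auto simp: semi_Eberlein_via_def closure_of_embedding)
  obtain S' :: "('a \<Rightarrow> real) set" and \<phi> f' where *: 
    "embedding_map X (real_power S') f'" "\<phi> ` S' \<subseteq> S" "inj_on \<phi> S'"
    "\<And>x s. x \<in> topspace X \<Longrightarrow> s \<in> S' \<Longrightarrow> f' x s = f x (\<phi> s)"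
    using reindex_embedding[OF comp emb] by metis
  have "f' x \<in> c0 S'" if x: "x \<in> topspace X" "f x \<in> c0 S" for x
  proof -
    have "f' x \<in> topspace (real_power S')"
      using *(1) x unfolding embedding_map_def
      by (metis IntD1 homeomorphic_imp_surjective_map imageI topspace_subtopology)
    moreover have "finite {s \<in> S'. \<bar>f' x s\<bar> > \<epsilon>}" if "\<epsilon> > 0" for \<epsilon>
    proof -
      have "finite {s \<in> S. \<bar>f x s\<bar> > \<epsilon>}"
        using x that by (auto simp: c0_def)
      then have "finite (\<phi> ` {s \<in> S'. \<bar>f' x s\<bar> > \<epsilon>})"
        by (rule finite_subset[rotated]) (use * x in auto)
      then show ?thesis
        using *(3) by (metis (no_types, lifting) finite_imageD inj_on_subset mem_Collect_eq subsetI)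
    qed
    ultimately show ?thesis by (simp add: c0_def)
  qed
  then have "X closure_of {x \<in> topspace X. f x \<in> c0 S} \<subseteq> X closure_of {x \<in> topspace X. f' x \<in> c0 S'}"
    by (intro closure_of_mono) auto
  then have "X closure_of {x \<in> topspace X. f' x \<in> c0 S'} = topspace X"
    using dense closure_of_subset_topspace by fastforce
  then have "semi_Eberlein_via S' X"
    unfolding semi_Eberlein_via_def using comp H *(1) closure_of_embedding[OF *(1)] by blast
  then show ?thesis by (auto simp: semi_Eberlein_def)
qed

end

theory Submission
  imports Defs
begin

text \<open>An uncountable branch of the tree would have as its union a club contained in \<open>A\<close>, so all
  branches are countable and characteristic functions embed the path space into a
  \<open>\<Sigma>\<close>-product. Forcing with the tree shoots a club through \<open>A\<close>; as \<open>A\<close> is stationary, no new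
  countable sequences are added, so the generic branch is a non-isolated P-point of the path space
  of the extension. A semi-Eberlein compact space has no such P-point \<open>b\<close>: the image of \<open>b\<close> has
  countable support, and points \<open>X n\<close> of the dense set, all different from \<open>b\<close>, whose differences
  with \<open>b\<close> have disjoint supports converge to \<open>b\<close>. In the ground model, each condition of this
  argument is met densely often, and the image of the generic branch becomes a single function
  \<open>F\<close> which is the image of two different branches.\<close>

section \<open>Clubs and stationary sets\<close>

lemma countable_strict_upper_bound:
  fixes B :: "omega1 set"
  assumes "countable B"
  shows "\<exists>b. \<forall>x\<in>B. x < b"
proof (rule ccontr)
  assume "\<nexists>b. \<forall>x\<in>B. x < b"
  then have "UNIV \<subseteq> (\<Union>x\<in>B. insert x {..<x})"
    by (fastforce simp: not_less le_less)
  moreover have "countable (\<Union>x\<in>B. insert x {..<x})"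
    using assms by (intro countable_UN) (auto intro: countable_lessThan_omega1)
  ultimately show False
    using uncountable_UNIV_omega1 countable_subset by blast
qed

text \<open>Iterate a function dominating \<open>\<sigma>\<close> on initial segments, starting at
  \<beta>. The orbit is strictly increasing, so its least strict upper bound is its supremum, and
  everything below that lies below some member of the orbit.\<close>

lemma closure_point_above:
  fixes \<sigma> :: "omega1 \<Rightarrow> omega1"
  obtains \<delta> where "\<beta> < \<delta>" "\<And>\<alpha>. \<alpha> < \<delta> \<Longrightarrow> \<sigma> \<alpha> < \<delta>"
proof -
  have "\<exists>c>b. \<forall>\<alpha>\<le>b. \<sigma> \<alpha> < c" for b
  proof -
    have "countable (insert b (\<sigma> ` (insert b {..<b})))"
      by (auto intro: countable_lessThan_omega1)
    then obtain c where "\<forall>x \<in> insert b (\<sigma> ` (insert b {..<b})). x < c"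
      using countable_strict_upper_bound by blast
    then show ?thesis by (intro exI[of _ c]) (auto simp: le_less)
  qed
  then obtain h where h: "\<And>b. b < h b" "\<And>b \<alpha>. \<alpha> \<le> b \<Longrightarrow> \<sigma> \<alpha> < h b"
    by metis
  define b where "b n = (h ^^ n) \<beta>" for n
  have bS: "b (Suc n) = h (b n)" for n by (simp add: b_def)
  obtain c where c: "\<And>n. b n < c"
    using countable_strict_upper_bound[of "range b"] by auto
  define \<delta> where "\<delta> = (LEAST c. \<forall>n. b n < c)"
  have \<delta>: "b n < \<delta>" for n
    unfolding \<delta>_def using LeastI[of "\<lambda>c. \<forall>n. b n < c"] c by blast
  show thesis
  proof
    show "\<beta> < \<delta>" using \<delta>[of 0] by (simp add: b_def)
    fix \<alpha> assume "\<alpha> < \<delta>"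
    then have "\<not> (\<forall>n. b n < \<alpha>)"
      unfolding \<delta>_def by (rule not_less_Least)
    then obtain n where "\<alpha> \<le> b n" by (auto simp: not_less)
    then have "\<sigma> \<alpha> < b (Suc n)" using h(2) bS by simp
    then show "\<sigma> \<alpha> < \<delta>" using \<delta>[of "Suc n"] by (rule less_trans)
  qed
qed

text \<open>Every ordinal below \<omega>1 has a successor, which turns the closed right end into an
  open one.\<close>

lemma open_greaterThanAtMost_omega1: "open {a<..b :: omega1}"
proof -
  obtain c where "b < c" using countable_strict_upper_bound[of "{b}"] by auto
  then have *: "b < (LEAST c. b < c)" by (rule LeastI)
  have "{a<..b} = {a<..<LEAST c. b < c}"
  proof (intro set_eqI iffI)
    fix x assume "x \<in> {a<..b}"
    then show "x \<in> {a<..<LEAST c. b < c}" using le_less_trans[OF _ *] by simp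
  next
    fix x assume x: "x \<in> {a<..<LEAST c. b < c}"
    then have "\<not> b < x" using not_less_Least[of x "\<lambda>c. b < c"] by simp
    with x show "x \<in> {a<..b}" by simp
  qed
  then show ?thesis by simp
qed

lemma club_closure_points: "club {\<delta>. \<beta> \<le> \<delta> \<and> (\<forall>\<alpha><\<delta>. \<sigma> \<alpha> < \<delta>)}"
  unfolding club_def
proof
  \<comment> \<open>An ordinal fails to be a closure point exactly when it lies in one of the
    intervals from \<alpha> (excluded) to \<open>\<sigma> \<alpha>\<close> (included), and these are
    open.\<close>
  have "{\<delta>. \<beta> \<le> \<delta> \<and> (\<forall>\<alpha><\<delta>. \<sigma> \<alpha> < \<delta>)} = {\<beta>..} \<inter> (\<Inter>\<alpha>. - {\<alpha><..\<sigma> \<alpha>})"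
    by (intro set_eqI) (simp, meson not_less)
  moreover have "closed ({\<beta>..} \<inter> (\<Inter>\<alpha>. - {\<alpha><..\<sigma> \<alpha>}))"
    by (intro closed_Int closed_INT ballI closed_Compl open_greaterThanAtMost_omega1 closed_atLeast)
  ultimately show "closed {\<delta>. \<beta> \<le> \<delta> \<and> (\<forall>\<alpha><\<delta>. \<sigma> \<alpha> < \<delta>)}"
    by simp
  show "\<forall>a. \<exists>b\<in>{\<delta>. \<beta> \<le> \<delta> \<and> (\<forall>\<alpha><\<delta>. \<sigma> \<alpha> < \<delta>)}. a < b"
  proof
    fix a
    obtain \<delta> where "max a \<beta> < \<delta>" "\<And>\<alpha>. \<alpha> < \<delta> \<Longrightarrow> \<sigma> \<alpha> < \<delta>"
      using closure_point_above by blast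
    then show "\<exists>b\<in>{\<delta>. \<beta> \<le> \<delta> \<and> (\<forall>\<alpha><\<delta>. \<sigma> \<alpha> < \<delta>)}. a < b"
      by (intro bexI[of _ \<delta>]) auto
  qed
qed

text \<open>The form in which stationarity is used in the tree: with \<open>A\<close> it gives
  limits of chains that may be added to a node, with \<open>- A\<close> limits that no node may
  contain.\<close>

lemma stationary_closure_point:
  assumes "stationary B"
  obtains \<delta> where "\<delta> \<in> B" "\<beta> < \<delta>" "\<And>\<alpha>. \<alpha> < \<delta> \<Longrightarrow> \<sigma> \<alpha> < \<delta>"
proof -
  obtain c where "\<beta> < c" using countable_strict_upper_bound[of "{\<beta>}"] by auto
  moreover have "B \<inter> {\<delta>. c \<le> \<delta> \<and> (\<forall>\<alpha><\<delta>. \<sigma> \<alpha> < \<delta>)} \<noteq> {}"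
    using assms club_closure_points by (auto simp: stationary_def)
  ultimately show thesis using that by fastforce
qed

lemma closed_limit_mem:
  fixes C :: "'a::linorder_topology set"
  assumes "closed C" "\<beta> < \<delta>" "\<And>\<alpha>. \<alpha> < \<delta> \<Longrightarrow> \<exists>c\<in>C. \<alpha> < c \<and> c \<le> \<delta>"
  shows "\<delta> \<in> C"
proof (rule ccontr)
  assume "\<delta> \<notin> C"
  then obtain \<alpha> where "\<alpha> < \<delta>" "{\<alpha><..\<delta>} \<subseteq> - C"
    using open_left[of "- C" \<delta> \<beta>] assms(1,2) by auto
  with assms(3) show False by fastforce
qed

text \<open>A closure point of a function that jumps past the next element of every
  \<open>C n\<close> is a limit of each \<open>C n\<close>, hence belongs to all of them.\<close>

lemma club_INT:
  fixes C :: "nat \<Rightarrow> omega1 set"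
  assumes "\<And>n. club (C n)"
  shows "club (\<Inter>n. C n)"
  unfolding club_def
proof
  show "closed (\<Inter>n. C n)" using assms by (auto simp: club_def)
  obtain c where c: "\<And>n a. c n a \<in> C n" "\<And>n a. a < c n a"
    using assms unfolding club_def by metis
  have "\<exists>b. \<forall>n. c n a < b" for a
    using countable_strict_upper_bound[of "range (\<lambda>n. c n a)"] by auto
  then obtain \<sigma> where \<sigma>: "\<And>a n. c n a < \<sigma> a" by metis
  show "\<forall>a. \<exists>b\<in>\<Inter>n. C n. a < b"
  proof
    fix a
    obtain \<delta> where \<delta>: "a < \<delta>" "\<And>\<alpha>. \<alpha> < \<delta> \<Longrightarrow> \<sigma> \<alpha> < \<delta>"
      using closure_point_above by blast
    have "\<delta> \<in> C n" for n
    proof (rule closed_limit_mem[OF _ \<delta>(1)])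
      show "closed (C n)" using assms by (auto simp: club_def)
      fix \<alpha> assume "\<alpha> < \<delta>"
      then show "\<exists>x\<in>C n. \<alpha> < x \<and> x \<le> \<delta>"
        using c \<sigma> \<delta>(2) by (meson less_imp_le less_trans)
    qed
    then show "\<exists>b\<in>\<Inter>n. C n. a < b" using \<delta>(1) by blast
  qed
qed

text \<open>The nonstationary sets form a \<sigma>-ideal, by intersecting countably many
  clubs.\<close>

lemma stationary_UN:
  fixes B :: "nat \<Rightarrow> omega1 set"
  assumes "stationary (\<Union>n. B n)"
  obtains n where "stationary (B n)"
proof (rule ccontr)
  assume "\<not> thesis"
  then have "\<forall>n. \<exists>C. club C \<and> B n \<inter> C = {}"
    using that by (auto simp: stationary_def)
  then obtain C where C: "\<And>n. club (C n)" "\<And>n. B n \<inter> C n = {}" by metis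
  then have "(\<Union>n. B n) \<inter> (\<Inter>n. C n) \<noteq> {}"
    using assms club_INT[of C] by (simp add: stationary_def)
  with C(2) show False by blast
qed

lemma stationary_mono: "stationary A \<Longrightarrow> A \<subseteq> B \<Longrightarrow> stationary B"
  by (fastforce simp: stationary_def)

text \<open>Ulam matrix: for injections \<open>e \<alpha>\<close> of \<open>{..<\<alpha>}\<close> into the naturals, the sets
  \<open>{\<alpha>. \<xi> < \<alpha> \<and> e \<alpha> \<xi> = n}\<close> for fixed \<open>n\<close> are pairwise disjoint, while for fixed \<open>\<xi>\<close> they
  cover a final segment.\<close>

lemma bistationary_exists: "\<exists>A. stationary A \<and> stationary (- A)"
proof -
  obtain e :: "omega1 \<Rightarrow> omega1 \<Rightarrow> nat" where e: "\<And>\<alpha>. inj_on (e \<alpha>) {..<\<alpha>}"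
    using countable_lessThan_omega1 unfolding countable_def by metis
  define U where "U n \<xi> = {\<alpha>. \<xi> < \<alpha> \<and> e \<alpha> \<xi> = n}" for n \<xi>
  have "\<exists>n. stationary (U n \<xi>)" for \<xi>
  proof -
    have "stationary {\<xi><..}" by (auto simp: stationary_def club_def)
    moreover have "{\<xi><..} = (\<Union>n. U n \<xi>)" by (auto simp: U_def)
    ultimately show ?thesis using stationary_UN by metis
  qed
  then obtain n where n: "\<And>\<xi>. stationary (U (n \<xi>) \<xi>)" by metis
  have "\<not> inj n" using uncountable_UNIV_omega1 by (auto simp: countable_def)
  then obtain \<xi> \<eta> where \<xi>\<eta>: "\<xi> \<noteq> \<eta>" "n \<xi> = n \<eta>" by (auto simp: inj_def)
  have "U (n \<eta>) \<eta> \<subseteq> - U (n \<xi>) \<xi>"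
    using e \<xi>\<eta> by (auto simp: U_def inj_on_def)
  then show ?thesis using n stationary_mono by blast
qed

section \<open>Initial segments and branches\<close>

abbreviation segment_le (infix "\<preceq>" 50) where "s \<preceq> t \<equiv> initial_segment s t"

lemma segment_refl [simp]: "s \<preceq> s"
  by (simp add: initial_segment_def)

lemma segment_trans [trans]: "s \<preceq> t \<Longrightarrow> t \<preceq> u \<Longrightarrow> s \<preceq> u"
  unfolding initial_segment_def by blast

lemma segment_subset: "s \<preceq> t \<Longrightarrow> s \<subseteq> t"
  by (simp add: initial_segment_def)

lemma segment_linear:
  assumes "s \<preceq> u" "t \<preceq> u"
  shows "s \<preceq> t \<or> t \<preceq> s"
proof (cases "s \<subseteq> t")
  case True
  then show ?thesis using assms unfolding initial_segment_def by blast
next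
  case False
  \<comment> \<open>A point of \<open>s\<close> missing from \<open>t\<close> lies above all of
    \<open>t\<close>, since \<open>t\<close> is downward closed in \<open>u\<close>.\<close>
  then obtain a where "a \<in> s" "a \<notin> t" by blast
  then have "b < a" if "b \<in> t" for b
    using assms that unfolding initial_segment_def by (metis not_less_iff_gr_or_eq subset_iff)
  then show ?thesis using assms \<open>a \<in> s\<close> unfolding initial_segment_def by blast
qed

lemma segment_insert: "(\<And>c. c \<in> t \<Longrightarrow> c < a) \<Longrightarrow> t \<preceq> insert a t"
  by (force simp: initial_segment_def)

lemma segment_chain:
  assumes "\<And>n. \<tau> n \<preceq> \<tau> (Suc n)" "m \<le> n"
  shows "\<tau> m \<preceq> \<tau> n"
  using assms(2) by (induction rule: dec_induct) (auto intro: segment_trans assms(1))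

lemma segment_chain_Union:
  assumes "\<And>n::nat. \<tau> n \<preceq> \<tau> (Suc n)"
  shows "\<tau> n \<preceq> (\<Union>n. \<tau> n)"
  unfolding initial_segment_def
proof (intro conjI ballI impI)
  fix b a assume "b \<in> \<tau> n" "a \<in> (\<Union>n. \<tau> n)" "a < b"
  then obtain m where "a \<in> \<tau> m" by blast
  moreover have "\<tau> m \<preceq> \<tau> n \<or> \<tau> n \<preceq> \<tau> m"
    using segment_chain[of \<tau>] assms by (metis nle_le)
  ultimately show "a \<in> \<tau> n"
    using \<open>b \<in> \<tau> n\<close> \<open>a < b\<close> unfolding initial_segment_def by blast
qed auto

text \<open>A point outside \<open>U\<close> but below an element \<open>c\<close> of a closed
  initial segment \<open>t\<close> has the neighbourhood \<open>{..<c} - t\<close>; a point above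
  all of \<open>U\<close> is separated by a ray. Both limits of chains with a top point added and
  unions of unbounded branches satisfy the hypotheses.\<close>

lemma closed_Union_segments:
  fixes U :: "'a::linorder_topology set"
  assumes "\<And>y. y \<notin> U \<Longrightarrow> (\<exists>t c. t \<preceq> U \<and> closed t \<and> c \<in> t \<and> y < c) \<or> (\<forall>c\<in>U. c < y)"
    and "\<And>y. \<forall>c\<in>U. c < y \<Longrightarrow> \<exists>d<y. \<forall>c\<in>U. c \<le> d"
  shows "closed U"
proof -
  have "\<exists>V. open V \<and> y \<in> V \<and> V \<subseteq> - U" if y: "y \<notin> U" for y
    using assms(1)[OF y]
  proof
    assume "\<exists>t c. t \<preceq> U \<and> closed t \<and> c \<in> t \<and> y < c"
    then obtain t c where t: "t \<preceq> U" "closed t" "c \<in> t" "y < c" by blast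
    have "{..<c} - t \<subseteq> - U" using t by (auto simp: initial_segment_def)
    moreover have "y \<in> {..<c} - t" using t y by (auto simp: initial_segment_def)
    moreover have "open ({..<c} - t)" using t(2) by (intro open_Diff) auto
    ultimately show ?thesis by blast
  next
    assume "\<forall>c\<in>U. c < y"
    then obtain d where "d < y" "\<forall>c\<in>U. c \<le> d" using assms(2) by blast
    then show ?thesis by (intro exI[of _ "{d<..}"]) (auto simp: not_less)
  qed
  then have "open (- U)" by (subst open_subopen) auto
  then show ?thesis by (simp add: closed_def)
qed

lemma branch_subset: "x \<in> initial_branches T le \<Longrightarrow> x \<subseteq> T"
  by (simp add: initial_branches_def)

lemma branch_down: "x \<in> initial_branches T le \<Longrightarrow> t \<in> x \<Longrightarrow> s \<in> T \<Longrightarrow> le s t \<Longrightarrow> s \<in> x"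
  by (cases "s = t") (auto simp: initial_branches_def)

lemma branch_linear: "x \<in> initial_branches T le \<Longrightarrow> s \<in> x \<Longrightarrow> t \<in> x \<Longrightarrow> le s t \<or> le t s"
  by (simp add: initial_branches_def)

lemma branch_below_chain:
  assumes "\<And>n::nat. \<tau> n \<preceq> \<tau> (Suc n)"
  shows "{s \<in> T. \<exists>n. s \<preceq> \<tau> n} \<in> initial_branches T initial_segment"
proof -
  have "s \<preceq> t \<or> t \<preceq> s" if "s \<preceq> \<tau> m" "t \<preceq> \<tau> n" for s t m n
  proof -
    have "\<tau> m \<preceq> \<tau> (max m n)" "\<tau> n \<preceq> \<tau> (max m n)"
      using segment_chain[of \<tau>] assms by auto
    then show ?thesis using that segment_linear segment_trans by metis
  qed
  then have "s \<preceq> t \<or> t \<preceq> s" if "\<exists>n. s \<preceq> \<tau> n" "\<exists>n. t \<preceq> \<tau> n" for s t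
    using that by blast
  then show ?thesis unfolding initial_branches_def by (blast intro: segment_trans)
qed

section \<open>The path space\<close>

lemma inj_on_restrict_indicator:
  "inj_on (\<lambda>x. restrict (indicator x) T :: 'a \<Rightarrow> 'b::zero_neq_one) (initial_branches T le)"
proof (rule inj_onI)
  fix x y assume xy: "x \<in> initial_branches T le" "y \<in> initial_branches T le"
    and eq: "restrict (indicator x) T = (restrict (indicator y) T :: 'a \<Rightarrow> 'b)"
  have "t \<in> x \<longleftrightarrow> t \<in> y" if "t \<in> T" for t
    using fun_cong[OF eq, of t] that by (cases "t \<in> x"; cases "t \<in> y") auto
  with xy show "x = y" using branch_subset by fastforce
qed

lemma embedding_path_space:
  "embedding_map (path_space T le) (cantor_cube T) (\<lambda>x. restrict (indicator x) T)"
proof -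
  let ?f = "\<lambda>x. restrict (indicator x) T :: _ \<Rightarrow> nat" and ?P = "initial_branches T le"
  have f: "?f x \<in> topspace (cantor_cube T)" for x
    by (auto simp: cantor_cube_def indicator_def)
  have op: "openin (path_space T le) S \<longleftrightarrow> (\<exists>U. openin (cantor_cube T) U \<and> S = ?f -` U \<inter> ?P)" for S
    by (simp add: path_space_def openin_pullback_topology)
  have "continuous_map (path_space T le) (subtopology (cantor_cube T) (?f ` ?P)) ?f"
    unfolding continuous_map_in_subtopology
  proof
    show "continuous_map (path_space T le) (cantor_cube T) ?f"
      using f by (auto simp: continuous_map_def op)
  qed auto
  moreover have "open_map (path_space T le) (subtopology (cantor_cube T) (?f ` ?P)) ?f"
    unfolding open_map_def op openin_subtopology by blast
  moreover have "?f ` topspace (path_space T le) = topspace (subtopology (cantor_cube T) (?f ` ?P))"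
    using f by auto
  moreover have "inj_on ?f (topspace (path_space T le))"
    by (simp add: inj_on_restrict_indicator)
  ultimately show ?thesis
    unfolding embedding_map_def topspace_path_space by (intro bijective_open_imp_homeomorphic_map) auto
qed

lemma continuous_map_indicator_path_space:
  assumes "t \<in> T"
  shows "continuous_map (path_space T le) (discrete_topology {0, 1 :: nat}) (\<lambda>x. indicator x t)"
proof -
  have "continuous_map (path_space T le) (cantor_cube T) (\<lambda>x. restrict (indicator x) T)"
    using embedding_path_space continuous_map_in_subtopology homeomorphic_imp_continuous_map
    unfolding embedding_map_def by blast
  then show ?thesis
    using assms by (auto simp: cantor_cube_def continuous_map_componentwise)
qed

lemma openin_cone_path_space:
  assumes "t \<in> T"
  shows "openin (path_space T le) {x \<in> initial_branches T le. t \<in> x}"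
proof -
  have "openin (path_space T le) {x \<in> topspace (path_space T le). indicator x t \<in> {1 :: nat}}"
    by (rule openin_continuous_map_preimage[OF continuous_map_indicator_path_space[OF assms]]) simp
  also have "{x \<in> topspace (path_space T le). indicator x t \<in> {1 :: nat}} =
      {x \<in> initial_branches T le. t \<in> x}"
    by (auto simp: indicator_def)
  finally show ?thesis .
qed

text \<open>Being an initial branch is a conjunction of conditions on two coordinates each, so the
  branches form a closed subset of the compact Cantor cube.\<close>

lemma compact_space_path_space: "compact_space (path_space T le)"
proof -
  let ?f = "\<lambda>x. restrict (indicator x) T :: _ \<Rightarrow> nat" and ?P = "initial_branches T le"
  let ?K = "cantor_cube T"
  have comp: "compact_space ?K"
    by (auto simp: cantor_cube_def compact_space_product_topology compact_space_discrete_topology)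
  define F where "F s t B C = {y \<in> topspace ?K. y s \<in> B} \<union> {y \<in> topspace ?K. y t \<in> C}"
    for s t and B C :: "nat set"
  have "closedin ?K {y \<in> topspace ?K. y s \<in> B}" if "s \<in> T" for s B
  proof -
    have "continuous_map ?K (discrete_topology {0, 1}) (\<lambda>y. y s)"
      unfolding cantor_cube_def using that by (rule continuous_map_product_projection)
    then have "closedin ?K {y \<in> topspace ?K. y s \<in> B \<inter> {0, 1}}"
      by (rule closedin_continuous_map_preimage) simp
    also have "{y \<in> topspace ?K. y s \<in> B \<inter> {0, 1}} = {y \<in> topspace ?K. y s \<in> B}"
      using that by (auto simp: cantor_cube_def PiE_def Pi_def)
    finally show ?thesis .
  qed
  then have cl: "closedin ?K (F s t B C)" if "s \<in> T" "t \<in> T" for s t B C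
    using that unfolding F_def by (intro closedin_Un) auto
  \<comment> \<open>The two families say that incomparable nodes are not both chosen and that a
    chosen node brings its predecessors. The whole cube keeps the intersection inside the cube even
    if there are no such conditions.\<close>
  define \<F> where "\<F> = insert (topspace ?K)
     ((\<lambda>(s, t). F s t {0} {0}) ` {(s, t). s \<in> T \<and> t \<in> T \<and> \<not> (le s t \<or> le t s)} \<union>
      (\<lambda>(s, t). F s t {1} {0}) ` {(s, t). s \<in> T \<and> t \<in> T \<and> le s t \<and> s \<noteq> t})"
  have "?f ` ?P = \<Inter>\<F>"
  proof (intro equalityI subsetI)
    fix y assume "y \<in> ?f ` ?P"
    then obtain x where "x \<in> ?P" "y = ?f x" by blast
    then show "y \<in> \<Inter>\<F>"
      by (auto simp: \<F>_def F_def cantor_cube_def indicator_def dest: branch_linear branch_down)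
  next
    fix y assume y: "y \<in> \<Inter>\<F>"
    then have yK: "y \<in> topspace ?K" by (simp add: \<F>_def)
    define x where "x = {t \<in> T. y t = 1}"
    have "y t = 0 \<or> y t = 1" if "t \<in> T" for t
      using yK that by (auto simp: cantor_cube_def PiE_def Pi_def)
    moreover have "y \<in> extensional T" using yK by (simp add: cantor_cube_def PiE_def)
    ultimately have "y = ?f x"
      by (auto simp: x_def indicator_def restrict_def extensional_def fun_eq_iff)
    moreover have "y \<in> F s t {0} {0}" if "s \<in> T" "t \<in> T" "\<not> (le s t \<or> le t s)" for s t
      using y that by (auto simp: \<F>_def)
    then have "le s t \<or> le t s" if "s \<in> x" "t \<in> x" for s t
      using that by (force simp: F_def x_def)
    moreover have "y \<in> F s t {1} {0}" if "s \<in> T" "t \<in> T" "le s t" "s \<noteq> t" for s t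
      using y that by (auto simp: \<F>_def)
    then have "s \<in> x" if "t \<in> x" "s \<in> T" "le s t" "s \<noteq> t" for s t
      using that by (force simp: F_def x_def)
    ultimately show "y \<in> ?f ` ?P"
      by (auto simp: initial_branches_def x_def)
  qed
  moreover have "closedin ?K (\<Inter>\<F>)"
    by (rule closedin_Inter) (auto simp: \<F>_def cl)
  ultimately have "compact_space (subtopology ?K (?f ` ?P))"
    using comp closedin_compact_space compact_space_subtopology by metis
  then show ?thesis
    using embedding_path_space[of T le] homeomorphic_compact_space homeomorphic_map_imp_homeomorphic_space
    unfolding embedding_map_def topspace_path_space by blast
qed

lemma Hausdorff_space_path_space: "Hausdorff_space (path_space T le)"
proof -
  have "Hausdorff_space (cantor_cube T)"
    by (simp add: cantor_cube_def Hausdorff_space_product_topology Hausdorff_space_discrete_topology)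
  then show ?thesis
    using embedding_path_space[of T le] homeomorphic_Hausdorff_space
      homeomorphic_map_imp_homeomorphic_space Hausdorff_space_subtopology
    unfolding embedding_map_def by metis
qed

text \<open>The topology is that of pointwise convergence of characteristic functions, and in a
  discrete factor convergence means being eventually constant.\<close>

lemma limitin_path_space:
  assumes "\<And>n. X n \<in> initial_branches T le" "z \<in> initial_branches T le"
    and "\<And>r. r \<in> T \<Longrightarrow> eventually (\<lambda>n. r \<in> X n \<longleftrightarrow> r \<in> z) sequentially"
  shows "limitin (path_space T le) X z sequentially"
proof -
  let ?f = "\<lambda>x. restrict (indicator x) T :: _ \<Rightarrow> nat"
  have "limitin (cantor_cube T) (\<lambda>n. ?f (X n)) (?f z) sequentially"
    unfolding cantor_cube_def limitin_componentwise
  proof (intro conjI ballI)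
    fix t assume t: "t \<in> T"
    have "eventually (\<lambda>n. ?f (X n) t = ?f z t) sequentially"
      using assms(3)[OF t] by eventually_elim (simp add: indicator_def)
    then have "eventually (\<lambda>n. ?f (X n) t \<in> U) sequentially" if "?f z t \<in> U" for U
      by eventually_elim (use that in simp)
    moreover have "?f z t \<in> {0, 1}" by (simp add: t indicator_def)
    ultimately show "limitin (discrete_topology {0, 1}) (\<lambda>n. ?f (X n) t) (?f z t) sequentially"
      unfolding limitin_def topspace_discrete_topology by blast
  qed (auto simp: indicator_def)
  then have lim: "eventually (\<lambda>n. ?f (X n) \<in> V) sequentially"
    if "openin (cantor_cube T) V" "?f z \<in> V" for V
    using that unfolding limitin_def by blast
  show ?thesis
    unfolding limitin_def
  proof (intro conjI allI impI)
    show "z \<in> topspace (path_space T le)" using assms(2) by simp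
    fix U assume U: "openin (path_space T le) U \<and> z \<in> U"
    then obtain V where V: "openin (cantor_cube T) V" "U = ?f -` V \<inter> initial_branches T le"
      by (auto simp: path_space_def openin_pullback_topology)
    then have "eventually (\<lambda>n. ?f (X n) \<in> V) sequentially" using U by (intro lim) auto
    then show "eventually (\<lambda>n. X n \<in> U) sequentially"
      by eventually_elim (use assms(1) V(2) in simp)
  qed
qed

text \<open>The support of the characteristic function of a branch is contained in the branch
  itself.\<close>

lemma Corson_compact_path_space:
  assumes "\<And>x. x \<in> initial_branches T le \<Longrightarrow> countable x"
  shows "Corson_compact (path_space T le)"
proof -
  let ?f = "\<lambda>x. restrict (indicator x) T :: _ \<Rightarrow> real" and ?X = "path_space T le"
  have "continuous_map ?X euclideanreal (\<lambda>x. indicator x t)" if "t \<in> T" for t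
  proof -
    have "continuous_map ?X euclideanreal (real \<circ> (\<lambda>x. indicator x t))"
      by (rule continuous_map_compose[OF continuous_map_indicator_path_space[OF that]]) simp
    then show ?thesis by (rule continuous_map_eq) (simp add: indicator_def)
  qed
  then have "continuous_map ?X (real_power T) ?f"
    by (auto simp: real_power_def continuous_map_componentwise)
  moreover have "inj_on ?f (topspace ?X)"
    by (simp add: inj_on_restrict_indicator)
  moreover have "Hausdorff_space (real_power T)"
    by (simp add: real_power_def Hausdorff_space_product_topology Hausdorff_space_euclidean)
  ultimately have "embedding_map ?X (real_power T) ?f"
    using continuous_imp_embedding_map compact_space_path_space by blast
  moreover have "?f x \<in> Sigma_product T" if "x \<in> initial_branches T le" for x
  proof -
    have "{t \<in> T. ?f x t \<noteq> 0} \<subseteq> x" by (auto simp: indicator_def)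
    then have "countable {t \<in> T. ?f x t \<noteq> 0}"
      using assms[OF that] countable_subset by blast
    then show ?thesis
      unfolding Sigma_product_def real_power_def by simp
  qed
  ultimately have "Corson_compact_via T ?X"
    unfolding Corson_compact_via_def embedding_map_in_subtopology
    using compact_space_path_space Hausdorff_space_path_space by fastforce
  then show ?thesis by (rule Corson_compactI)
qed

section \<open>The tree of closed subsets of a bistationary set\<close>

text \<open>Bookkeeping shared by the two chain constructions below: since \<delta> is countable,
  its predecessors can be enumerated as \<open>d n\<close>, and step \<open>n\<close> performs the
  task \<open>e n\<close> and then climbs above \<open>d n\<close>.\<close>

lemma cofinal_chain:
  fixes e :: "nat \<Rightarrow> omega1 set \<Rightarrow> omega1 set"
  assumes "t\<^sub>0 \<in> N" "\<alpha> < \<delta>"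
    and "\<And>n t \<beta>. t \<in> N \<Longrightarrow> \<beta> < \<delta> \<Longrightarrow> \<exists>t'\<in>N. e n t \<preceq> t' \<and> (\<exists>c\<in>t'. \<beta> < c)"
    and "\<And>n t. t \<in> N \<Longrightarrow> t \<preceq> e n t"
  obtains \<tau> where "\<tau> 0 = t\<^sub>0" "\<And>n. \<tau> n \<in> N" "\<And>n. e n (\<tau> n) \<preceq> \<tau> (Suc n)"
    "\<And>n. \<tau> n \<preceq> \<tau> (Suc n)" "\<And>\<beta>. \<beta> < \<delta> \<Longrightarrow> \<exists>n. \<exists>c\<in>\<tau> n. \<beta> < c"
proof -
  define d where "d = from_nat_into {..<\<delta>}"
  have d: "range d = {..<\<delta>}"
    unfolding d_def using assms(2) by (intro range_from_nat_into countable_lessThan_omega1) auto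
  then have "\<forall>n. \<forall>t\<in>N. \<exists>t'. t' \<in> N \<and> e n t \<preceq> t' \<and> (\<exists>c\<in>t'. d n < c)"
    using assms(3) by blast
  then obtain h where h: "\<And>n t. t \<in> N \<Longrightarrow> h n t \<in> N \<and> e n t \<preceq> h n t \<and> (\<exists>c\<in>h n t. d n < c)"
    by metis
  define \<tau> where "\<tau> = rec_nat t\<^sub>0 h"
  have [simp]: "\<tau> 0 = t\<^sub>0" "\<And>n. \<tau> (Suc n) = h n (\<tau> n)" by (simp_all add: \<tau>_def)
  have N: "\<tau> n \<in> N" for n by (induction n) (simp_all add: assms(1) h)
  show thesis
  proof
    fix n show "e n (\<tau> n) \<preceq> \<tau> (Suc n)" using h N by simp
    with assms(4)[OF N] show "\<tau> n \<preceq> \<tau> (Suc n)" by (rule segment_trans)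
  next
    fix \<beta> assume "\<beta> < \<delta>"
    then obtain n where "\<beta> = d n" using d by blast
    then have "\<exists>c\<in>\<tau> (Suc n). \<beta> < c" using h N by simp
    then show "\<exists>n. \<exists>c\<in>\<tau> n. \<beta> < c" by blast
  qed (simp_all add: N)
qed

lemma closed_chain_limit:
  fixes \<tau> :: "nat \<Rightarrow> 'a::linorder_topology set"
  assumes "\<And>n. closed (\<tau> n)" "\<And>n. \<tau> n \<preceq> \<tau> (Suc n)" "\<And>n c. c \<in> \<tau> n \<Longrightarrow> c < \<delta>"
    and "\<And>\<beta>. \<beta> < \<delta> \<Longrightarrow> \<exists>n. \<exists>c\<in>\<tau> n. \<beta> < c"
  shows "closed (insert \<delta> (\<Union>n. \<tau> n))" "\<tau> n \<preceq> insert \<delta> (\<Union>n. \<tau> n)"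
proof -
  have *: "\<tau> n \<preceq> insert \<delta> (\<Union>n. \<tau> n)" for n
    by (rule segment_trans[OF segment_chain_Union segment_insert]) (use assms in auto)
  show "closed (insert \<delta> (\<Union>n. \<tau> n))"
  proof (rule closed_Union_segments)
    fix y assume y: "y \<notin> insert \<delta> (\<Union>n. \<tau> n)"
    show "(\<exists>t c. t \<preceq> insert \<delta> (\<Union>n. \<tau> n) \<and> closed t \<and> c \<in> t \<and> y < c) \<or>
        (\<forall>c\<in>insert \<delta> (\<Union>n. \<tau> n). c < y)"
    proof (cases "y < \<delta>")
      case True
      then show ?thesis using assms(1,4) * by blast
    next
      case False
      then have "\<delta> < y" using y by auto
      then show ?thesis using assms(3) less_trans by blast
    qed
  next
    fix y assume "\<forall>c\<in>insert \<delta> (\<Union>n. \<tau> n). c < y"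
    then show "\<exists>d<y. \<forall>c\<in>insert \<delta> (\<Union>n. \<tau> n). c \<le> d"
      using assms(3) by (intro exI[of _ \<delta>]) (auto simp: less_imp_le)
  qed
  show "\<tau> n \<preceq> insert \<delta> (\<Union>n. \<tau> n)" by (rule *)
qed

section \<open>Nodes and branches for a bistationary set\<close>

locale bistationary =
  fixes A :: "omega1 set"
  assumes stat: "stationary A" and costat: "stationary (- A)"
begin

abbreviation "T \<equiv> closed_subsets A"
abbreviation "P \<equiv> initial_branches T initial_segment"
abbreviation "K \<equiv> path_space T initial_segment"

text \<open>An unbounded closed subset of \<open>A\<close> would be a club missing the stationary
  set \<open>- A\<close>.\<close>

lemma closed_subset_bounded:
  assumes "closed t" "t \<subseteq> A"
  shows "\<exists>b. \<forall>c\<in>t. c < b"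
proof (rule ccontr)
  assume "\<not> ?thesis"
  then have *: "\<exists>c\<in>t. b \<le> c" for b by (meson not_less)
  have "\<exists>c\<in>t. a < c" for a
  proof -
    obtain b where "a < b" using countable_strict_upper_bound[of "{a}"] by auto
    with * show ?thesis by (meson less_le_trans)
  qed
  then have "club t" using assms by (auto simp: club_def)
  then show False using costat assms by (auto simp: stationary_def)
qed

lemma node_bounded:
  assumes "t \<in> T"
  shows "\<exists>b. \<forall>c\<in>t. c < b"
  using assms closed_subset_bounded[of t] by (auto simp: closed_subsets_def)

lemma insert_node: "t \<in> T \<Longrightarrow> a \<in> A \<Longrightarrow> insert a t \<in> T"
  by (auto simp: closed_subsets_def)

lemma unbounded: "\<exists>a\<in>A. b < a"
  using stationary_closure_point[OF stat, of b id] by blast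

text \<open>Adding two different points above \<open>t\<close> gives two incomparable extensions,
  and a branch cannot contain both.\<close>

lemma extension_avoiding_branch:
  assumes "t \<in> T" "x \<in> P"
  obtains r where "r \<in> T" "t \<preceq> r" "r \<notin> x"
proof -
  obtain b where b: "\<And>c. c \<in> t \<Longrightarrow> c < b" using node_bounded assms(1) by blast
  obtain a where a: "a \<in> A" "b < a" using unbounded by blast
  obtain a' where a': "a' \<in> A" "a < a'" using unbounded by blast
  have lt: "c < a" "c < a'" if "c \<in> t" for c
    using b[OF that] a(2) a'(2) by (meson less_trans)+
  have "\<not> insert a t \<preceq> insert a' t" "\<not> insert a' t \<preceq> insert a t"
    using lt a'(2) by (auto simp: initial_segment_def)
  then have "insert a t \<notin> x \<or> insert a' t \<notin> x" using branch_linear[OF assms(2)] by blast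
  moreover have "t \<preceq> insert a t" "t \<preceq> insert a' t" using lt by (auto intro: segment_insert)
  ultimately show thesis using that insert_node assms(1) a(1) a'(1) by metis
qed

text \<open>The union of an unbounded branch would be a club contained in \<open>A\<close>.\<close>

lemma countable_branch:
  assumes x: "x \<in> P"
  shows "countable x"
proof -
  define U where "U = \<Union>x"
  have xT: "t \<subseteq> A" "closed t" if "t \<in> x" for t
    using branch_subset[OF x] that by (auto simp: closed_subsets_def)
  have seg: "t \<preceq> U" if "t \<in> x" for t
    unfolding initial_segment_def
  proof (intro conjI ballI impI)
    fix b a assume ba: "b \<in> t" "a \<in> U" "a < b"
    then obtain u where "a \<in> u" "u \<in> x" by (auto simp: U_def)
    with ba that branch_linear[OF x, of t u] show "a \<in> t" unfolding initial_segment_def by blast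
  qed (use that in \<open>auto simp: U_def\<close>)
  have "\<exists>b. \<forall>c\<in>U. c \<le> b"
  proof (rule ccontr)
    assume "\<nexists>b. \<forall>c\<in>U. c \<le> b"
    then have unb: "\<exists>c\<in>U. b < c" for b by (meson not_le)
    have "closed U"
    proof (rule closed_Union_segments)
      fix y assume "y \<notin> U"
      obtain c t where "c \<in> t" "t \<in> x" "y < c" using unb[of y] by (auto simp: U_def)
      then show "(\<exists>t c. t \<preceq> U \<and> closed t \<and> c \<in> t \<and> y < c) \<or> (\<forall>c\<in>U. c < y)"
        using seg xT by blast
    next
      fix y assume "\<forall>c\<in>U. c < y"
      with unb[of y] show "\<exists>d<y. \<forall>c\<in>U. c \<le> d" by (meson not_less_iff_gr_or_eq)
    qed
    moreover have "U \<subseteq> A" using xT by (auto simp: U_def)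
    ultimately obtain b where "\<forall>c\<in>U. c < b" using closed_subset_bounded by blast
    with unb[of b] show False by (meson less_asym)
  qed
  then obtain b where "U \<subseteq> insert b {..<b}" by (auto simp: le_less)
  then have "countable U" by (rule countable_subset) (simp add: countable_lessThan_omega1)
  \<comment> \<open>Each node of the branch is an initial segment of \<open>U\<close>, so a proper
    one is determined by the least point of \<open>U\<close> that it misses.\<close>
  moreover have "x \<subseteq> insert U ((\<lambda>c. U \<inter> {..<c}) ` U)"
  proof
    fix t assume t: "t \<in> x"
    show "t \<in> insert U ((\<lambda>c. U \<inter> {..<c}) ` U)"
    proof (cases "t = U")
      case False
      let ?Q = "\<lambda>c. c \<in> U \<and> c \<notin> t"
      define c where "c = (LEAST c. ?Q c)"
      have "\<exists>c. ?Q c" using False seg[OF t] by (auto simp: initial_segment_def)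
      then have c: "c \<in> U" "c \<notin> t" unfolding c_def using LeastI_ex[of ?Q] by blast+
      have "t = U \<inter> {..<c}"
      proof (intro equalityI subsetI IntI)
        fix d assume d: "d \<in> t"
        then show "d \<in> U" using seg[OF t] by (auto simp: initial_segment_def)
        have "\<not> c < d" using d c seg[OF t] by (auto simp: initial_segment_def)
        moreover have "c \<noteq> d" using d c by blast
        ultimately show "d \<in> {..<c}" by auto
      next
        fix d assume "d \<in> U \<inter> {..<c}"
        then show "d \<in> t" using not_less_Least[of d ?Q] by (auto simp: c_def)
      qed
      with c(1) show ?thesis by blast
    qed simp
  qed
  ultimately show ?thesis by (metis countable_image countable_insert countable_subset)
qed

section \<open>Chains with and without upper bounds\<close>

lemma unbounded_chain:
  assumes "t \<in> T"
  obtains \<tau> where "\<tau> 0 = t" "\<And>n. \<tau> n \<in> T" "\<And>n. \<tau> n \<preceq> \<tau> (Suc n)"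
    "\<And>r. r \<in> T \<Longrightarrow> \<not> (\<forall>n. \<tau> n \<preceq> r)"
proof -
  obtain b where b: "\<And>c. c \<in> t \<Longrightarrow> c < b" using node_bounded assms by blast
  obtain \<sigma> where \<sigma>: "\<And>\<alpha>. \<sigma> \<alpha> \<in> A" "\<And>\<alpha>. \<alpha> < \<sigma> \<alpha>" using unbounded by metis
  \<comment> \<open>A closed set end-extending a chain cofinal in \<delta> must contain \<delta>, so
    choosing \<delta> outside \<open>A\<close> rules out every upper bound in the tree.\<close>
  obtain \<delta> where \<delta>: "\<delta> \<in> - A" "b < \<delta>" "\<And>\<alpha>. \<alpha> < \<delta> \<Longrightarrow> \<sigma> \<alpha> < \<delta>"
    using stationary_closure_point[OF costat, of b \<sigma>] by blast
  \<comment> \<open>The bound lies strictly below \<delta>, so that a point of \<open>A\<close> can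
    be added above it without reaching \<delta>.\<close>
  define N where "N = {t \<in> T. \<exists>\<beta><\<delta>. \<forall>c\<in>t. c \<le> \<beta>}"
  have "\<exists>t'\<in>N. t \<preceq> t' \<and> (\<exists>c\<in>t'. \<beta> < c)" if t: "t \<in> N" and \<beta>: "\<beta> < \<delta>" for t \<beta>
  proof -
    obtain \<gamma> where \<gamma>: "\<gamma> < \<delta>" "\<forall>c\<in>t. c \<le> \<gamma>" using t by (auto simp: N_def)
    let ?a = "\<sigma> (max \<beta> \<gamma>)"
    have a: "?a < \<delta>" using \<gamma> \<beta> \<delta>(3) by simp
    have gt: "\<beta> < ?a" "\<gamma> < ?a" using \<sigma>(2)[of "max \<beta> \<gamma>"] by auto
    have "c < ?a" if "c \<in> t" for c using \<gamma>(2) gt(2) that by (meson le_less_trans)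
    then have "t \<preceq> insert ?a t" "\<forall>c\<in>insert ?a t. c \<le> ?a" by (auto intro: segment_insert less_imp_le)
    moreover have "insert ?a t \<in> T" using t \<sigma>(1) by (auto simp: N_def intro: insert_node)
    ultimately show ?thesis using a gt(1) by (intro bexI[of _ "insert ?a t"]) (auto simp: N_def)
  qed
  moreover have "t \<in> N" using assms b \<delta>(2) by (auto simp: N_def intro: less_imp_le)
  ultimately obtain \<tau> where \<tau>: "\<tau> 0 = t" "\<And>n. \<tau> n \<in> N" "\<And>n. \<tau> n \<preceq> \<tau> (Suc n)"
    "\<And>\<beta>. \<beta> < \<delta> \<Longrightarrow> \<exists>n. \<exists>c\<in>\<tau> n. \<beta> < c"
    using cofinal_chain[of t N b \<delta> "\<lambda>_ t. t"] \<delta>(2) segment_refl by metis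
  have "\<not> (\<forall>n. \<tau> n \<preceq> r)" if r: "r \<in> T" for r
  proof
    assume *: "\<forall>n. \<tau> n \<preceq> r"
    have "\<delta> \<in> r"
    proof (rule closed_limit_mem[OF _ \<delta>(2)])
      show "closed r" using r by (simp add: closed_subsets_def)
      fix \<alpha> assume "\<alpha> < \<delta>"
      then obtain n c where "c \<in> \<tau> n" "\<alpha> < c" using \<tau>(4) by blast
      moreover have "c \<le> \<delta>" using \<tau>(2)[of n] \<open>c \<in> \<tau> n\<close> by (auto simp: N_def)
      ultimately show "\<exists>c\<in>r. \<alpha> < c \<and> c \<le> \<delta>" using * segment_subset by blast
    qed
    then show False using r \<delta>(1) by (auto simp: closed_subsets_def)
  qed
  with \<tau> that show thesis by (auto simp: N_def)
qed

text \<open>Baire property: at a closure point \<open>\<delta>\<close> in \<open>A\<close> of the countable families \<open>M \<alpha>\<close> of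
  nodes, the limit of a chain cofinal in \<open>\<delta>\<close> is again a node.\<close>

lemma chain_upper_bound:
  assumes t0: "t\<^sub>0 \<in> T"
    and e: "\<And>n t. t \<in> T \<Longrightarrow> e n t \<in> T" "\<And>n t. t \<in> T \<Longrightarrow> t \<preceq> e n t"
  obtains \<tau> r where "\<tau> 0 = t\<^sub>0" "\<And>n::nat. \<tau> n \<in> T" "\<And>n. e n (\<tau> n) \<preceq> \<tau> (Suc n)"
    "\<And>n. \<tau> n \<preceq> r" "r \<in> T"
proof -
  \<comment> \<open>\<open>M \<alpha>\<close> is the closure of \<open>t\<^sub>0\<close> under all
    \<open>e n\<close> and under adding points of \<open>A\<close> below \<alpha>. It stays
    countable because \<alpha> is countable; these families stand in for a chain of countable
    elementary submodels.\<close>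
  define Mstep where "Mstep \<alpha> M = M \<union> (\<Union>n. e n ` M) \<union>
    (\<lambda>(a, t). insert a t) ` ({a \<in> A. a < \<alpha>} \<times> M)" for \<alpha> M
  define M where "M \<alpha> = (\<Union>k. (Mstep \<alpha> ^^ k) {t\<^sub>0})" for \<alpha>
  have M_step: "Mstep \<alpha> (M \<alpha>) \<subseteq> M \<alpha>" for \<alpha>
  proof -
    have "Mstep \<alpha> (M \<alpha>) \<subseteq> (\<Union>k. (Mstep \<alpha> ^^ Suc k) {t\<^sub>0})"
      unfolding M_def by (fastforce simp: Mstep_def)
    then show ?thesis unfolding M_def by blast
  qed
  have M0: "t\<^sub>0 \<in> M \<alpha>" for \<alpha>
  proof -
    have "t\<^sub>0 \<in> (Mstep \<alpha> ^^ 0) {t\<^sub>0}" by simp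
    then show ?thesis unfolding M_def by blast
  qed
  have Me: "e n t \<in> M \<alpha>" if "t \<in> M \<alpha>" for n t \<alpha>
    using M_step[of \<alpha>] that by (auto simp: Mstep_def)
  have Mi: "insert a t \<in> M \<alpha>" if "t \<in> M \<alpha>" "a \<in> A" "a < \<alpha>" for a t \<alpha>
    using M_step[of \<alpha>] that by (auto simp: Mstep_def)
  have "countable ((Mstep \<alpha> ^^ k) {t\<^sub>0})" for \<alpha> k
  proof (induction k)
    case (Suc k)
    have "countable {a \<in> A. a < \<alpha>}"
      by (rule countable_subset[OF _ countable_lessThan_omega1[of \<alpha>]]) auto
    with Suc show ?case by (simp add: Mstep_def)
  qed simp
  then have M_countable: "countable (M \<alpha>)" for \<alpha> by (simp add: M_def)
  have "(Mstep \<alpha> ^^ k) {t\<^sub>0} \<subseteq> T" for \<alpha> k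
    by (induction k) (auto simp: Mstep_def t0 e(1) insert_node)
  then have M_T: "M \<alpha> \<subseteq> T" for \<alpha> by (auto simp: M_def)
  have "(Mstep \<alpha> ^^ k) {t\<^sub>0} \<subseteq> (Mstep \<beta> ^^ k) {t\<^sub>0}" if "\<alpha> \<le> \<beta>" for \<alpha> \<beta> k
  proof (induction k)
    case (Suc k)
    moreover have "Mstep \<alpha> X \<subseteq> Mstep \<beta> Y" if "X \<subseteq> Y" for X Y
    proof -
      have "{a \<in> A. a < \<alpha>} \<times> X \<subseteq> {a \<in> A. a < \<beta>} \<times> Y"
        using that less_le_trans[OF _ \<open>\<alpha> \<le> \<beta>\<close>] by blast
      then show ?thesis
        using that unfolding Mstep_def by (intro Un_mono UN_mono image_mono) auto
    qed
    ultimately show ?case by simp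
  qed simp
  then have M_mono: "M \<alpha> \<subseteq> M \<beta>" if "\<alpha> \<le> \<beta>" for \<alpha> \<beta>
    using that unfolding M_def by blast
  \<comment> \<open>The function \<open>\<sigma>\<close> built from these bounds exceeds every point
    of every node in \<open>M \<alpha>\<close> and leaves room for a further point of
    \<open>A\<close> above \<alpha>.\<close>
  have "\<exists>b. (\<forall>t\<in>M \<alpha>. \<forall>c\<in>t. c < b) \<and> (\<exists>a\<in>A. \<alpha> < a \<and> a < b)" for \<alpha>
  proof -
    obtain bd where bd: "\<forall>t\<in>T. \<forall>c\<in>t. c < bd t" using node_bounded by metis
    obtain a where a: "a \<in> A" "\<alpha> < a" using unbounded by blast
    obtain b where b: "\<forall>x \<in> insert a (bd ` M \<alpha>). x < b"
      using countable_strict_upper_bound[of "insert a (bd ` M \<alpha>)"] M_countable by auto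
    have "c < b" if "t \<in> M \<alpha>" "c \<in> t" for t c
    proof -
      have "c < bd t" using bd M_T that by blast
      also have "bd t < b" using b that(1) by blast
      finally show ?thesis .
    qed
    then show ?thesis using a b by blast
  qed
  then obtain \<sigma> where \<sigma>: "\<And>\<alpha> t c. t \<in> M \<alpha> \<Longrightarrow> c \<in> t \<Longrightarrow> c < \<sigma> \<alpha>"
      "\<And>\<alpha>. \<exists>a\<in>A. \<alpha> < a \<and> a < \<sigma> \<alpha>"
    by metis
  \<comment> \<open>An arbitrary ordinal below \<delta>, so that \<delta> has a predecessor and
    \<open>N\<close> contains \<open>t\<^sub>0\<close>.\<close>
  fix \<beta>\<^sub>0 :: omega1
  obtain \<delta> where \<delta>: "\<delta> \<in> A" "\<beta>\<^sub>0 < \<delta>" "\<And>\<alpha>. \<alpha> < \<delta> \<Longrightarrow> \<sigma> \<alpha> < \<delta>"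
    using stationary_closure_point[OF stat, of \<beta>\<^sub>0 \<sigma>] by blast
  define N where "N = (\<Union>\<alpha>\<in>{..<\<delta>}. M \<alpha>)"
  have "\<exists>t'\<in>N. e n t \<preceq> t' \<and> (\<exists>c\<in>t'. \<beta> < c)" if t: "t \<in> N" and \<beta>: "\<beta> < \<delta>" for n t \<beta>
  proof -
    obtain \<alpha> where \<alpha>: "\<alpha> < \<delta>" "t \<in> M \<alpha>" using t by (auto simp: N_def)
    let ?\<gamma> = "max \<beta> (\<sigma> \<alpha>)"
    have \<gamma>: "?\<gamma> < \<delta>" using \<alpha> \<beta> \<delta>(3) by simp
    obtain a where a: "a \<in> A" "?\<gamma> < a" "a < \<sigma> ?\<gamma>" using \<sigma>(2) by blast
    \<comment> \<open>This index is large enough for \<open>M\<close> to contain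
      \<open>e n t\<close> and to admit the new point \<open>a\<close>, yet it is still below
      \<delta>.\<close>
    let ?\<mu> = "max \<alpha> (\<sigma> ?\<gamma>)"
    have \<mu>: "?\<mu> < \<delta>" using \<alpha> \<gamma> \<delta>(3) by simp
    have "e n t \<in> M ?\<mu>" using Me[OF \<alpha>(2)] M_mono[of \<alpha> ?\<mu>] by auto
    then have "insert a (e n t) \<in> M ?\<mu>" by (rule Mi) (use a in \<open>auto simp: less_max_iff_disj\<close>)
    with \<mu> have "insert a (e n t) \<in> N" unfolding N_def by blast
    moreover have "c < a" if "c \<in> e n t" for c
      using \<sigma>(1)[OF Me[OF \<alpha>(2)] that] a(2) by auto
    then have "e n t \<preceq> insert a (e n t)" by (rule segment_insert)
    ultimately show ?thesis using a(2) by (intro bexI[of _ "insert a (e n t)"]) auto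
  qed
  moreover have "t\<^sub>0 \<in> N" using M0 \<delta>(2) by (auto simp: N_def)
  moreover have "t \<preceq> e n t" if "t \<in> N" for n t using that e(2) M_T by (auto simp: N_def)
  ultimately obtain \<tau> where \<tau>: "\<tau> 0 = t\<^sub>0" "\<And>n. \<tau> n \<in> N" "\<And>n. e n (\<tau> n) \<preceq> \<tau> (Suc n)"
    "\<And>n. \<tau> n \<preceq> \<tau> (Suc n)" "\<And>\<beta>. \<beta> < \<delta> \<Longrightarrow> \<exists>n. \<exists>c\<in>\<tau> n. \<beta> < c"
    using cofinal_chain[of t\<^sub>0 N \<beta>\<^sub>0 \<delta> e] \<delta>(2) by metis
  have \<tau>T: "\<tau> n \<in> T" for n using \<tau>(2)[of n] M_T by (auto simp: N_def)
  have "c < \<delta>" if "c \<in> \<tau> n" for n c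
    using \<tau>(2)[of n] that \<sigma>(1) \<delta>(3) unfolding N_def by (metis UN_E lessThan_iff less_trans)
  then have "closed (insert \<delta> (\<Union>n. \<tau> n))" "\<And>n. \<tau> n \<preceq> insert \<delta> (\<Union>n. \<tau> n)"
    using closed_chain_limit[of \<tau> \<delta>] \<tau>(4,5) \<tau>T by (simp_all add: closed_subsets_def)
  moreover from this(1) have "insert \<delta> (\<Union>n. \<tau> n) \<in> T"
    using \<tau>T \<delta>(1) by (auto simp: closed_subsets_def)
  ultimately show thesis using that \<tau> \<tau>T by blast
qed

section \<open>Deciding values of continuous functions\<close>

lemma seq_continuous:
  assumes "continuous_map K euclideanreal g" "\<And>n. X n \<in> P" "z \<in> P"
    and "\<And>r. r \<in> T \<Longrightarrow> eventually (\<lambda>n. r \<in> X n \<longleftrightarrow> r \<in> z) sequentially"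
  shows "(\<lambda>n. g (X n)) \<longlonglongrightarrow> g z"
  using continuous_map_limit[OF assms(1) limitin_path_space[OF assms(2-4)]] by (simp add: comp_def)

text \<open>A branch without an upper bound in the tree has the cones of its nodes as a neighbourhood
  base, so every continuous function has small oscillation on one of them.\<close>

lemma small_oscillation:
  assumes g: "continuous_map K euclideanreal g" and t: "t \<in> T" and "\<epsilon> > 0"
  shows "\<exists>r\<in>T. t \<preceq> r \<and> (\<forall>x\<in>P. \<forall>y\<in>P. r \<in> x \<longrightarrow> r \<in> y \<longrightarrow> \<bar>g x - g y\<bar> < \<epsilon>)"
proof (rule ccontr)
  assume neg: "\<not> ?thesis"
  obtain \<tau> where \<tau>: "\<tau> 0 = t" "\<And>n. \<tau> n \<in> T" "\<And>n. \<tau> n \<preceq> \<tau> (Suc n)"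
    and no_bound: "\<And>r. r \<in> T \<Longrightarrow> \<not> (\<forall>n. \<tau> n \<preceq> r)"
    using unbounded_chain[OF t] by blast
  define z where "z = {s \<in> T. \<exists>n. s \<preceq> \<tau> n}"
  have z: "z \<in> P" unfolding z_def using \<tau>(3) by (rule branch_below_chain)
  have "t \<preceq> \<tau> n" for n using segment_chain[of \<tau> 0 n] \<tau> by simp
  then have "\<exists>x y. x \<in> P \<and> y \<in> P \<and> \<tau> n \<in> x \<and> \<tau> n \<in> y \<and> \<epsilon> \<le> \<bar>g x - g y\<bar>" for n
    using neg \<tau>(2)[of n] by (meson not_le)
  then obtain X Y where XY: "\<And>n. X n \<in> P" "\<And>n. Y n \<in> P" "\<And>n. \<tau> n \<in> X n" "\<And>n. \<tau> n \<in> Y n"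
      "\<And>n. \<epsilon> \<le> \<bar>g (X n) - g (Y n)\<bar>"
    by metis
  \<comment> \<open>Any branches through the nodes \<open>\<tau> n\<close> converge to
    \<open>z\<close>: a node outside \<open>z\<close> is not below any \<open>\<tau> n\<close>, and
    it is not above all of them, so it is incompatible with almost all. Stated for arbitrary
    \<open>W\<close> to serve both \<open>X\<close> and \<open>Y\<close>.\<close>
  have "eventually (\<lambda>n. r \<in> W n \<longleftrightarrow> r \<in> z) sequentially"
    if r: "r \<in> T" and W: "\<And>n. W n \<in> P" "\<And>n. \<tau> n \<in> W n" for r W
  proof (cases "r \<in> z")
    case True
    then obtain m where m: "r \<preceq> \<tau> m" by (auto simp: z_def)
    have "r \<in> W n" if "m \<le> n" for n
      using branch_down[OF W(1) W(2) r] segment_trans[OF m segment_chain[of \<tau>]] \<tau>(3) that by blast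
    with True show ?thesis by (auto simp: eventually_sequentially)
  next
    case False
    obtain m where m: "\<not> \<tau> m \<preceq> r" using no_bound[OF r] by blast
    have "r \<notin> W n" if "m \<le> n" for n
    proof
      assume "r \<in> W n"
      then have "r \<preceq> \<tau> n \<or> \<tau> n \<preceq> r" using branch_linear[OF W(1) _ W(2)] by blast
      moreover have "\<tau> m \<preceq> \<tau> n" using segment_chain[of \<tau>] \<tau>(3) that by blast
      ultimately show False using False r m segment_trans by (auto simp: z_def)
    qed
    with False show ?thesis by (auto simp: eventually_sequentially)
  qed
  then have "(\<lambda>n. g (X n)) \<longlonglongrightarrow> g z" "(\<lambda>n. g (Y n)) \<longlonglongrightarrow> g z"
    using XY by (auto intro!: seq_continuous[OF g _ z])
  then have "(\<lambda>n. \<bar>g (X n) - g (Y n)\<bar>) \<longlonglongrightarrow> \<bar>g z - g z\<bar>"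
    by (intro tendsto_intros)
  then have "\<epsilon> \<le> \<bar>g z - g z\<bar>"
    by (rule LIMSEQ_le_const) (use XY(5) in blast)
  with \<open>\<epsilon> > 0\<close> show False by simp
qed

text \<open>Each pair of a function in the family and a tolerance 1/(k+1) is one task, solved by
  \<open>small_oscillation\<close>. An upper bound of a chain performing all tasks makes every
  oscillation zero.\<close>

lemma decide_countably_many:
  assumes g: "\<And>s. s \<in> S \<Longrightarrow> continuous_map K euclideanreal (g s)" and "countable S" and t: "t \<in> T"
  shows "\<exists>r\<in>T. t \<preceq> r \<and> (\<forall>s\<in>S. \<forall>x\<in>P. \<forall>y\<in>P. r \<in> x \<longrightarrow> r \<in> y \<longrightarrow> g s x = g s y)"
proof (cases "S = {}")
  case True
  then show ?thesis using t segment_refl by blast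
next
  case False
  define s where "s n = from_nat_into S (fst (prod_decode n))" for n
  define \<epsilon> where "\<epsilon> n = inverse (real (Suc (snd (prod_decode n))))" for n
  have "s n \<in> S" "\<epsilon> n > 0" for n
    using from_nat_into[OF False] by (simp_all add: s_def \<epsilon>_def)
  then have "\<forall>n. \<forall>t\<in>T. \<exists>r. r \<in> T \<and> t \<preceq> r \<and>
      (\<forall>x\<in>P. \<forall>y\<in>P. r \<in> x \<longrightarrow> r \<in> y \<longrightarrow> \<bar>g (s n) x - g (s n) y\<bar> < \<epsilon> n)"
    using small_oscillation g by blast
  then obtain e where e: "\<And>n t. t \<in> T \<Longrightarrow> e n t \<in> T \<and> t \<preceq> e n t \<and>
      (\<forall>x\<in>P. \<forall>y\<in>P. e n t \<in> x \<longrightarrow> e n t \<in> y \<longrightarrow> \<bar>g (s n) x - g (s n) y\<bar> < \<epsilon> n)"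
    by metis
  obtain \<tau> r where \<tau>: "\<tau> 0 = t" "\<And>n. \<tau> n \<in> T" "\<And>n. e n (\<tau> n) \<preceq> \<tau> (Suc n)"
      "\<And>n. \<tau> n \<preceq> r" "r \<in> T"
    using chain_upper_bound[OF t, of e] e by metis
  have "g u x = g u y" if "u \<in> S" and xy: "x \<in> P" "y \<in> P" "r \<in> x" "r \<in> y" for u x y
  proof (rule ccontr)
    assume "g u x \<noteq> g u y"
    then obtain k where k: "inverse (real (Suc k)) < \<bar>g u x - g u y\<bar>"
      using reals_Archimedean[of "\<bar>g u x - g u y\<bar>"] by auto
    obtain i where i: "u = from_nat_into S i"
      using from_nat_into_surj[OF \<open>countable S\<close> \<open>u \<in> S\<close>] by auto
    define n where "n = prod_encode (i, k)"
    have n: "s n = u" "\<epsilon> n = inverse (real (Suc k))" by (simp_all add: n_def s_def \<epsilon>_def i)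
    have "e n (\<tau> n) \<preceq> r" using \<tau>(3,4) segment_trans by blast
    then have "e n (\<tau> n) \<in> x" "e n (\<tau> n) \<in> y"
      using branch_down[OF xy(1,3)] branch_down[OF xy(2,4)] e[OF \<tau>(2)] by blast+
    with e[OF \<tau>(2), of n n] xy n k show False by fastforce
  qed
  moreover have "t \<preceq> r" using \<tau>(1,4) by metis
  ultimately show ?thesis using \<tau>(5) by blast
qed

lemma principal_branch: "t \<in> T \<Longrightarrow> {s \<in> T. s \<preceq> t} \<in> P"
  using branch_below_chain[of "\<lambda>_. t"] by simp

end

section \<open>Refuting a semi-Eberlein embedding\<close>

locale semi_Eberlein_paths = bistationary +
  fixes S :: "'s set" and f :: "omega1 set set \<Rightarrow> 's \<Rightarrow> real"
  assumes cont: "\<And>s. s \<in> S \<Longrightarrow> continuous_map K euclideanreal (\<lambda>x. f x s)"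
    and dense: "\<And>t. t \<in> T \<Longrightarrow> \<exists>x\<in>P. t \<in> x \<and> f x \<in> c0 S"
    and separating: "\<And>x y. x \<in> P \<Longrightarrow> y \<in> P \<Longrightarrow> (\<And>s. s \<in> S \<Longrightarrow> f x s = f y s) \<Longrightarrow> x = y"
begin

text \<open>In forcing terms, the coordinates at which \<open>r\<close> forces the image of the
  generic branch to exceed \<epsilon> in absolute value.\<close>

definition large :: "real \<Rightarrow> omega1 set \<Rightarrow> 's set" where
  "large \<epsilon> r = {s \<in> S. \<forall>x\<in>P. r \<in> x \<longrightarrow> \<epsilon> < \<bar>f x s\<bar>}"

text \<open>Density supplies a branch through \<open>r\<close> with image in \<open>c0 S\<close>,
  and that one branch already bounds the set.\<close>

lemma finite_large:
  assumes "r \<in> T" "\<epsilon> > 0"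
  shows "finite (large \<epsilon> r)"
proof -
  obtain x where x: "x \<in> P" "r \<in> x" "f x \<in> c0 S" using dense assms(1) by blast
  have "finite {s \<in> S. \<bar>f x s\<bar> > \<epsilon>}" using x(3) assms(2) by (simp add: c0_def)
  then show ?thesis by (rule finite_subset[rotated]) (use x in \<open>auto simp: large_def\<close>)
qed

lemma large_mono:
  assumes "r \<in> T" "r \<preceq> r'"
  shows "large \<epsilon> r \<subseteq> large \<epsilon> r'"
  using assms branch_down[of _ T initial_segment r' r] by (auto simp: large_def)

text \<open>Otherwise the sets could be enlarged strictly infinitely often along a chain with an
  upper bound \<open>u\<close>, and the finite set \<open>large \<epsilon> u\<close> would contain
  them all.\<close>

lemma large_stabilizes:
  assumes t: "t \<in> T" and "\<epsilon> > 0"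
  shows "\<exists>r\<in>T. t \<preceq> r \<and> (\<forall>r'\<in>T. r \<preceq> r' \<longrightarrow> large \<epsilon> r' = large \<epsilon> r)"
proof (rule ccontr)
  assume neg: "\<not> ?thesis"
  \<comment> \<open>Growth is only demanded above \<open>t\<close>; elsewhere \<open>r\<close>
    itself is taken, so that the extension function is defined on all nodes as
    \<open>chain_upper_bound\<close> asks.\<close>
  have "\<forall>r\<in>T. \<exists>r'. r' \<in> T \<and> r \<preceq> r' \<and> (t \<preceq> r \<longrightarrow> large \<epsilon> r \<subset> large \<epsilon> r')"
  proof
    fix r assume r: "r \<in> T"
    show "\<exists>r'. r' \<in> T \<and> r \<preceq> r' \<and> (t \<preceq> r \<longrightarrow> large \<epsilon> r \<subset> large \<epsilon> r')"
    proof (cases "t \<preceq> r")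
      case True
      then obtain r' where "r' \<in> T" "r \<preceq> r'" "large \<epsilon> r' \<noteq> large \<epsilon> r" using neg r by blast
      with large_mono[OF r] show ?thesis by blast
    next
      case False
      then show ?thesis using r segment_refl by blast
    qed
  qed
  then obtain e where e: "\<And>r. r \<in> T \<Longrightarrow> e r \<in> T \<and> r \<preceq> e r \<and> (t \<preceq> r \<longrightarrow> large \<epsilon> r \<subset> large \<epsilon> (e r))"
    by metis
  obtain \<tau> u where \<tau>: "\<tau> 0 = t" "\<And>n. \<tau> n \<in> T" "\<And>n. e (\<tau> n) \<preceq> \<tau> (Suc n)"
      "\<And>n. \<tau> n \<preceq> u" "u \<in> T"
    using chain_upper_bound[OF t, of "\<lambda>_. e"] e by metis
  have \<tau>S: "\<tau> n \<preceq> \<tau> (Suc n)" for n using e \<tau>(2,3) segment_trans by blast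
  have fin: "finite (large \<epsilon> (\<tau> n))" for n using finite_large \<tau>(2) \<open>\<epsilon> > 0\<close> by blast
  have "n \<le> card (large \<epsilon> (\<tau> n))" for n
  proof (induction n)
    case (Suc n)
    have "t \<preceq> \<tau> n" using segment_chain[of \<tau> 0 n] \<tau>S \<tau>(1) by simp
    then have "large \<epsilon> (\<tau> n) \<subset> large \<epsilon> (e (\<tau> n))" using e \<tau>(2) by blast
    also have "\<dots> \<subseteq> large \<epsilon> (\<tau> (Suc n))" using large_mono e \<tau>(2,3) by blast
    finally have "card (large \<epsilon> (\<tau> n)) < card (large \<epsilon> (\<tau> (Suc n)))"
      using fin psubset_card_mono by blast
    with Suc show ?case by simp
  qed simp
  moreover have "card (large \<epsilon> (\<tau> n)) \<le> card (large \<epsilon> u)" for n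
    using card_mono[OF finite_large[OF \<tau>(5) \<open>\<epsilon> > 0\<close>] large_mono] \<tau>(2,4) by blast
  ultimately have "n \<le> card (large \<epsilon> u)" for n using le_trans by blast
  then show False using not_less_eq_eq by blast
qed

text \<open>Stabilize for the k-th threshold at step k of a chain; stability passes to every
  extension, hence to an upper bound.\<close>

lemma large_stabilizes_all:
  "\<exists>p\<in>T. \<forall>k. \<forall>r\<in>T. p \<preceq> r \<longrightarrow> large (inverse (real (Suc k))) r = large (inverse (real (Suc k))) p"
proof -
  let ?\<epsilon> = "\<lambda>k. inverse (real (Suc k))"
  have "{} \<in> T" by (simp add: closed_subsets_def)
  have "\<forall>k. \<forall>t\<in>T. \<exists>r. r \<in> T \<and> t \<preceq> r \<and> (\<forall>r'\<in>T. r \<preceq> r' \<longrightarrow> large (?\<epsilon> k) r' = large (?\<epsilon> k) r)"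
    using large_stabilizes by (metis inverse_positive_iff_positive of_nat_0_less_iff zero_less_Suc)
  then obtain e where e: "\<And>k t. t \<in> T \<Longrightarrow> e k t \<in> T \<and> t \<preceq> e k t \<and>
      (\<forall>r'\<in>T. e k t \<preceq> r' \<longrightarrow> large (?\<epsilon> k) r' = large (?\<epsilon> k) (e k t))"
    by metis
  obtain \<tau> p where \<tau>: "\<And>n. \<tau> n \<in> T" "\<And>n. e n (\<tau> n) \<preceq> \<tau> (Suc n)" "\<And>n. \<tau> n \<preceq> p" and p: "p \<in> T"
    using chain_upper_bound[OF \<open>{} \<in> T\<close>, of e] e by metis
  have *: "e k (\<tau> k) \<preceq> p" for k using \<tau>(2,3) segment_trans by blast
  have "large (?\<epsilon> k) r = large (?\<epsilon> k) p" if r: "r \<in> T" "p \<preceq> r" for k r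
  proof -
    have "e k (\<tau> k) \<preceq> r" using * r(2) by (rule segment_trans)
    then have "large (?\<epsilon> k) r = large (?\<epsilon> k) (e k (\<tau> k))" using e[OF \<tau>(1)] r(1) by blast
    also have "\<dots> = large (?\<epsilon> k) p" using e[OF \<tau>(1)] * p by blast
    finally show ?thesis .
  qed
  with p show ?thesis by blast
qed

text \<open>In forcing terms \<open>F\<close> is the image of the generic branch, which already lies in the
  ground model.\<close>

lemma generic_value:
  "\<exists>p\<in>T. \<exists>F. (\<forall>s\<in>S. \<forall>x\<in>P. p \<in> x \<longrightarrow> F s \<noteq> 0 \<longrightarrow> f x s = F s) \<and>
    (\<forall>s\<in>S. \<forall>r\<in>T. p \<preceq> r \<longrightarrow> (\<forall>x\<in>P. \<forall>y\<in>P. r \<in> x \<longrightarrow> r \<in> y \<longrightarrow> f x s = f y s) \<longrightarrow>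
      (\<forall>x\<in>P. r \<in> x \<longrightarrow> f x s = F s))"
proof -
  let ?\<epsilon> = "\<lambda>k. inverse (real (Suc k))"
  obtain q where q: "q \<in> T" "\<And>k r. r \<in> T \<Longrightarrow> q \<preceq> r \<Longrightarrow> large (?\<epsilon> k) r = large (?\<epsilon> k) q"
    using large_stabilizes_all by metis
  \<comment> \<open>Beyond \<open>q\<close> no further coordinate is ever forced to be bounded away
    from 0, so \<open>S'\<close> is the support of the generic image; it is countable as a union of
    finite sets.\<close>
  define S' where "S' = (\<Union>k. large (?\<epsilon> k) q)"
  have "S' \<subseteq> S" by (auto simp: S'_def large_def)
  moreover have "countable S'"
    unfolding S'_def using finite_large[OF q(1)] by (intro countable_UN) (auto intro: countable_finite)
  ultimately have "\<exists>p\<in>T. q \<preceq> p \<and> (\<forall>s\<in>S'. \<forall>x\<in>P. \<forall>y\<in>P. p \<in> x \<longrightarrow> p \<in> y \<longrightarrow> f x s = f y s)"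
    by (intro decide_countably_many cont q(1)) auto
  then obtain p where p: "p \<in> T" "q \<preceq> p"
    and decide: "\<forall>s\<in>S'. \<forall>x\<in>P. \<forall>y\<in>P. p \<in> x \<longrightarrow> p \<in> y \<longrightarrow> f x s = f y s"
    by blast
  \<comment> \<open>On \<open>S'\<close> all branches through \<open>p\<close> agree, and the
    principal branch of \<open>p\<close> is a convenient one to read off the common value.\<close>
  define F where "F s = (if s \<in> S' then f {u \<in> T. u \<preceq> p} s else 0)" for s
  have F: "f x s = F s" if "s \<in> S'" "x \<in> P" "p \<in> x" for s x
  proof -
    have "p \<in> {u \<in> T. u \<preceq> p}" using p(1) by simp
    then have "f x s = f {u \<in> T. u \<preceq> p} s"
      by (rule decide[rule_format, OF that(1,2) principal_branch[OF p(1)] that(3)])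
    then show ?thesis using that(1) by (simp add: F_def)
  qed
  show ?thesis
  proof (intro bexI exI conjI ballI impI)
    show "p \<in> T" by (rule p)
    show "f x s = F s" if "x \<in> P" "p \<in> x" "F s \<noteq> 0" for s x
      using F that by (metis F_def)
    fix s r x
    assume s: "s \<in> S" and r: "r \<in> T" "p \<preceq> r" and x: "x \<in> P" "r \<in> x"
      and const: "\<forall>x\<in>P. \<forall>y\<in>P. r \<in> x \<longrightarrow> r \<in> y \<longrightarrow> f x s = f y s"
    show "f x s = F s"
    proof (cases "s \<in> S'")
      case True
      then show ?thesis using F x branch_down[OF x p(1) r(2)] by blast
    next
      case False
      \<comment> \<open>A nonzero value common to all branches through \<open>r\<close> exceeds some
        threshold, which would put \<open>s\<close> into \<open>large\<close> at \<open>r\<close>,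
        hence at \<open>q\<close>.\<close>
      have "f x s = 0"
      proof (rule ccontr)
        assume "f x s \<noteq> 0"
        then obtain k where "?\<epsilon> k < \<bar>f x s\<bar>" using reals_Archimedean[of "\<bar>f x s\<bar>"] by auto
        moreover have "f y s = f x s" if "y \<in> P" "r \<in> y" for y using const x that by blast
        ultimately have "s \<in> large (?\<epsilon> k) r" using s by (simp add: large_def)
        also have "large (?\<epsilon> k) r = large (?\<epsilon> k) q" using q(2) r p(2) segment_trans by blast
        finally show False using False by (auto simp: S'_def)
      qed
      then show ?thesis using False by (simp add: F_def)
    qed
  qed
qed

lemma countable_support:
  assumes "f x \<in> c0 S"
  shows "countable {s \<in> S. f x s \<noteq> 0}"
proof -
  have "{s \<in> S. f x s \<noteq> 0} \<subseteq> (\<Union>k. {s \<in> S. \<bar>f x s\<bar> > inverse (real (Suc k))})"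
    using reals_Archimedean[of "\<bar>f x _\<bar>"] by fastforce
  moreover have "countable (\<Union>k. {s \<in> S. \<bar>f x s\<bar> > inverse (real (Suc k))})"
    using assms by (intro countable_UN) (auto simp: c0_def intro!: countable_finite)
  ultimately show ?thesis by (rule countable_subset)
qed

text \<open>Two different branches with image \<open>F\<close> are obtained as limits of points \<open>X n\<close> mapped
  into \<open>c0 S\<close>: the next node \<open>\<tau> (Suc n)\<close> fixes all values on the support of \<open>X n\<close> and is
  avoided by \<open>X n\<close>, so that \<open>X n\<close> converges to the branch below the chain \<open>\<tau>\<close>.\<close>

lemma contradiction: False
proof -
  obtain p F where p: "p \<in> T"
    and F: "\<forall>s\<in>S. \<forall>x\<in>P. p \<in> x \<longrightarrow> F s \<noteq> 0 \<longrightarrow> f x s = F s"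
    and decided: "\<forall>s\<in>S. \<forall>r\<in>T. p \<preceq> r \<longrightarrow>
      (\<forall>x\<in>P. \<forall>y\<in>P. r \<in> x \<longrightarrow> r \<in> y \<longrightarrow> f x s = f y s) \<longrightarrow>
      (\<forall>x\<in>P. r \<in> x \<longrightarrow> f x s = F s)"
    using generic_value by blast
  \<comment> \<open>One round of the construction: a branch \<open>x\<close> through
    \<open>r\<close>, and an extension \<open>r'\<close> off \<open>x\<close> that decides every
    coordinate in the support of \<open>f x\<close>.\<close>
  define Q where "Q r x r' \<longleftrightarrow> x \<in> P \<and> r \<in> x \<and> r' \<in> T \<and> r \<preceq> r' \<and> r' \<notin> x \<and>
    (\<forall>s\<in>S. f x s \<noteq> 0 \<longrightarrow> (\<forall>y\<in>P. \<forall>y'\<in>P. r' \<in> y \<longrightarrow> r' \<in> y' \<longrightarrow> f y s = f y' s))" for r x r'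
  have "\<forall>r\<in>T. \<exists>x r'. Q r x r'"
  proof
    fix r assume r: "r \<in> T"
    obtain x where x: "x \<in> P" "r \<in> x" "f x \<in> c0 S" using dense r by blast
    obtain u where u: "u \<in> T" "r \<preceq> u" "u \<notin> x" using extension_avoiding_branch[OF r x(1)] by blast
    obtain r' where r': "r' \<in> T" "u \<preceq> r'"
      "\<forall>s\<in>{s \<in> S. f x s \<noteq> 0}. \<forall>y\<in>P. \<forall>y'\<in>P. r' \<in> y \<longrightarrow> r' \<in> y' \<longrightarrow> f y s = f y' s"
      using decide_countably_many[of "{s \<in> S. f x s \<noteq> 0}" "\<lambda>s x. f x s" u]
        cont countable_support[OF x(3)] u(1) by auto
    have "r' \<notin> x" using branch_down[OF x(1) _ u(1) r'(2)] u(3) by blast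
    then have "Q r x r'"
      unfolding Q_def using x r' segment_trans[OF u(2) r'(2)] by blast
    then show "\<exists>x r'. Q r x r'" by blast
  qed
  then obtain X\<^sub>0 e where "\<And>r. r \<in> T \<Longrightarrow> Q r (X\<^sub>0 r) (e r)" by metis
  then have X\<^sub>0: "\<And>r. r \<in> T \<Longrightarrow> X\<^sub>0 r \<in> P" "\<And>r. r \<in> T \<Longrightarrow> r \<in> X\<^sub>0 r"
    and e: "\<And>r. r \<in> T \<Longrightarrow> e r \<in> T" "\<And>r. r \<in> T \<Longrightarrow> r \<preceq> e r" "\<And>r. r \<in> T \<Longrightarrow> e r \<notin> X\<^sub>0 r"
    and dec: "\<And>r s y y'. r \<in> T \<Longrightarrow> s \<in> S \<Longrightarrow> f (X\<^sub>0 r) s \<noteq> 0 \<Longrightarrow> y \<in> P \<Longrightarrow> y' \<in> P \<Longrightarrow>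
      e r \<in> y \<Longrightarrow> e r \<in> y' \<Longrightarrow> f y s = f y' s"
    unfolding Q_def by blast+
  \<comment> \<open>Every node above \<open>p\<close> lies on a branch with image \<open>F\<close>,
    which leaves the freedom to choose two such branches that differ.\<close>
  have limit: "\<exists>z\<in>P. r \<in> z \<and> (\<forall>s\<in>S. f z s = F s)" if r: "r \<in> T" "p \<preceq> r" for r
  proof -
    define \<tau> where "\<tau> n = (e ^^ n) r" for n
    have \<tau>_Suc: "\<tau> (Suc n) = e (\<tau> n)" for n by (simp add: \<tau>_def)
    have \<tau>T: "\<tau> n \<in> T" for n by (induction n) (simp_all add: \<tau>_def r e(1))
    have \<tau>S: "\<tau> n \<preceq> \<tau> (Suc n)" for n using e(2)[OF \<tau>T] by (simp add: \<tau>_Suc)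
    have mono: "\<tau> m \<preceq> \<tau> n" if "m \<le> n" for m n by (rule segment_chain[of \<tau>, OF \<tau>S that])
    have p\<tau>: "p \<preceq> \<tau> n" for n
      using mono[of 0 n] r(2) segment_trans by (simp add: \<tau>_def)
    define X where "X n = X\<^sub>0 (\<tau> n)" for n
    have X: "X n \<in> P" "\<tau> n \<in> X n" "\<tau> (Suc n) \<notin> X n" for n
      using X\<^sub>0 e(3) \<tau>T by (simp_all add: X_def \<tau>_Suc)
    define z where "z = {s \<in> T. \<exists>n. s \<preceq> \<tau> n}"
    have z: "z \<in> P" unfolding z_def using \<tau>S by (rule branch_below_chain)
    have conv: "eventually (\<lambda>n. v \<in> X n \<longleftrightarrow> v \<in> z) sequentially" if v: "v \<in> T" for v
    proof (cases "v \<in> z")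
      case True
      then obtain m where m: "v \<preceq> \<tau> m" by (auto simp: z_def)
      have "v \<in> X n" if "m \<le> n" for n
        using branch_down[OF X(1,2) v] segment_trans[OF m mono[OF that]] by blast
      with True show ?thesis by (auto simp: eventually_sequentially)
    next
      case False
      have above: "\<tau> n \<preceq> v" if "v \<in> X n" for n
        using branch_linear[OF X(1) that X(2)] False v by (auto simp: z_def)
      have "\<exists>m. \<forall>n\<ge>m. v \<notin> X n"
      \<comment> \<open>The chain may have upper bounds here. Such a \<open>v\<close> is excluded
        from every \<open>X n\<close>, since with \<open>v\<close> the branch would contain
        \<open>\<tau> (Suc n)\<close>.\<close>
      proof (cases "\<forall>m. \<tau> m \<preceq> v")
        case True
        then show ?thesis using branch_down[OF X(1) _ \<tau>T] X(3) by blast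
      next
        case False
        then show ?thesis using above mono segment_trans by blast
      qed
      with False show ?thesis by (auto simp: eventually_sequentially)
    qed
    have "f z s = F s" if s: "s \<in> S" for s
    proof -
      have "eventually (\<lambda>n. f (X n) s = F s) sequentially"
      \<comment> \<open>If \<open>s\<close> is in the support of some \<open>X m\<close>, then
        \<open>\<tau> (Suc m)\<close> decides it and all later values are \<open>F s\<close>.
        Otherwise all values are 0, and so is \<open>F s\<close>, because a nonzero
        \<open>F s\<close> would be attained at \<open>X 0\<close>.\<close>
      proof (cases "\<exists>m. f (X m) s \<noteq> 0")
        case True
        then obtain m where m: "f (X m) s \<noteq> 0" by blast
        have "\<forall>x\<in>P. \<forall>y\<in>P. \<tau> (Suc m) \<in> x \<longrightarrow> \<tau> (Suc m) \<in> y \<longrightarrow> f x s = f y s"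
          using dec[OF \<tau>T s] m unfolding X_def \<tau>_Suc by blast
        then have "\<forall>x\<in>P. \<tau> (Suc m) \<in> x \<longrightarrow> f x s = F s"
          by (rule mp[OF mp[OF bspec[OF bspec[OF decided s] \<tau>T] p\<tau>]])
        moreover have "\<tau> (Suc m) \<in> X n" if "Suc m \<le> n" for n
          using branch_down[OF X(1,2) \<tau>T mono[OF that]] .
        ultimately have "f (X n) s = F s" if "Suc m \<le> n" for n
          using that X(1) by blast
        then show ?thesis by (auto simp: eventually_sequentially)
      next
        case False
        have "p \<in> X 0" using branch_down[OF X(1,2) p p\<tau>] .
        then have "F s = 0" using F[rule_format, OF s X(1)] False by metis
        with False show ?thesis by simp
      qed
      then have "(\<lambda>n. f (X n) s) \<longlonglongrightarrow> F s" by (rule tendsto_eventually)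
      moreover have "(\<lambda>n. f (X n) s) \<longlonglongrightarrow> f z s"
        by (rule seq_continuous[OF cont[OF s] X(1) z conv])
      ultimately show ?thesis using LIMSEQ_unique by blast
    qed
    moreover have "r \<in> z" unfolding z_def using r(1) by (auto simp: \<tau>_def intro: exI[of _ 0])
    ultimately show ?thesis using z by blast
  qed
  obtain z where z: "z \<in> P" "\<forall>s\<in>S. f z s = F s" using limit[OF p segment_refl] by blast
  \<comment> \<open>A branch through this \<open>r\<close> necessarily differs from
    \<open>z\<close>, yet it can be chosen with the same image \<open>F\<close>, against
    injectivity.\<close>
  obtain r where r: "r \<in> T" "p \<preceq> r" "r \<notin> z" using extension_avoiding_branch[OF p z(1)] by blast
  obtain z' where "z' \<in> P" "r \<in> z'" "\<forall>s\<in>S. f z' s = F s" using limit[OF r(1,2)] by blast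
  with z r(3) separating[of z z'] show False by auto
qed

end

lemma (in bistationary) not_semi_Eberlein_path_space: "\<not> semi_Eberlein K"
proof
  assume "semi_Eberlein K"
  then obtain S and f :: "_ \<Rightarrow> (omega1 set set \<Rightarrow> real) \<Rightarrow> real" where emb: "embedding_map K (real_power S) f"
    and "subtopology (real_power S) (f ` topspace K) closure_of (c0 S \<inter> f ` topspace K) = f ` topspace K"
    unfolding semi_Eberlein_def semi_Eberlein_via_def by blast
  then have dense: "K closure_of {x \<in> topspace K. f x \<in> c0 S} = topspace K"
    by (simp only: closure_of_embedding)
  have h: "homeomorphic_map K (subtopology (real_power S) (f ` topspace K)) f"
    using emb by (simp add: embedding_map_def)
  then have cf: "continuous_map K (real_power S) f"
    using homeomorphic_imp_continuous_map continuous_map_in_subtopology by blast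
  have inj: "inj_on f P" using homeomorphic_imp_injective_map[OF h] by simp
  interpret semi_Eberlein_paths A S f
  proof
    show "continuous_map K euclideanreal (\<lambda>x. f x s)" if "s \<in> S" for s
      using cf that by (auto simp: real_power_def continuous_map_componentwise)
    show "\<exists>x\<in>P. t \<in> x \<and> f x \<in> c0 S" if t: "t \<in> T" for t
    proof -
      \<comment> \<open>The cone of \<open>t\<close> is an open neighbourhood of the principal
        branch of \<open>t\<close>, so it meets the dense set.\<close>
      let ?x = "{s \<in> T. s \<preceq> t}" and ?D = "{x \<in> topspace K. f x \<in> c0 S}" and ?C = "{x \<in> P. t \<in> x}"
      have "?x \<in> K closure_of ?D" using dense principal_branch[OF t] by simp
      then have "?x \<in> ?C \<and> openin K ?C \<longrightarrow> (\<exists>y. y \<in> ?D \<and> y \<in> ?C)"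
        unfolding in_closure_of by (elim conjE allE)
      moreover have "?x \<in> ?C" using principal_branch[OF t] t by simp
      ultimately have "\<exists>y. y \<in> ?D \<and> y \<in> ?C" using openin_cone_path_space[OF t] by blast
      then show ?thesis by auto
    qed
    show "x = y" if "x \<in> P" "y \<in> P" "\<And>s. s \<in> S \<Longrightarrow> f x s = f y s" for x y
    proof -
      have "f x \<in> extensional S" "f y \<in> extensional S"
        using cf that(1,2) by (auto simp: real_power_def continuous_map_componentwise)
      then have "f x = f y" using that(3) by (rule extensionalityI)
      then show ?thesis using inj that(1,2) by (auto dest: inj_onD)
    qed
  qed
  show False by (rule contradiction)
qed

theorem mainTheorem7:
  shows "(\<exists>X :: omega1 set set topology. Corson_compact X \<and> \<not> semi_Eberlein X) \<and>
    (\<forall>A :: omega1 set. stationary A \<and> stationary (- A) \<longrightarrow>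
      Corson_compact (path_space (closed_subsets A) initial_segment) \<and>
      \<not> semi_Eberlein (path_space (closed_subsets A) initial_segment))"
proof -
  have *: "Corson_compact (path_space (closed_subsets A) initial_segment) \<and>
      \<not> semi_Eberlein (path_space (closed_subsets A) initial_segment)"
    if "stationary A" "stationary (- A)" for A
  proof -
    interpret bistationary A by standard (rule that)+
    show ?thesis
      using Corson_compact_path_space countable_branch not_semi_Eberlein_path_space by blast
  qed
  \<comment> \<open>The existence claim needs one bistationary set, which the Ulam matrix
    provides.\<close>
  obtain A where "stationary A" "stationary (- A)" using bistationary_exists by blast
  with * show ?thesis by blast
qed

end
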